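(* There exists a metric, strictly ergodic, distal flow $(W,S)$ which admits a 2-fold minimal self-joining that is not strictly ergodic: there are points $w,w'\in W$ such that the flow $(W,w,S)\vee(W,w',S)$ is minimal but not strictly ergodic.
   Context: A flow $(X,T)$ is a compact Hausdorff space $X$ with a self-homeomorphism $T$; it is minimal if every orbit is dense, and strictly ergodic if it is minimal and has exactly one $T$-invariant Borel probability measure. A flow is metric if $X$ is metrizable; a metric flow is distal if $x\neq y$ implies $\inf_{n\in\mathbb{Z}}d(T^nx,T^ny)>0$. For $w,w'\in W$, $(W,w,S)\vee(W,w',S)$ denotes the orbit closure of $(w,w')$ in $W\times W$ under $S\times S$, with the action of $S\times S$. *)

theory Defs
  imports "HOL-Analysis.Analysis"
begin

text \<open>
  A flow is given by an abstract topology \<open>X\<close> and a map \<open>T\<close>; only the values of \<open>T\<close> on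
  \<open>topspace X\<close> matter.  Every compact metrizable space is homeomorphic to a subspace of the Hilbert
  cube, so for existence statements about metric flows the carrier type \<open>nat \<Rightarrow> real\<close> loses no
  generality.
\<close>

definition flow :: "'a topology \<Rightarrow> ('a \<Rightarrow> 'a) \<Rightarrow> bool" where
  "flow X T \<longleftrightarrow> compact_space X \<and> Hausdorff_space X \<and> homeomorphic_map X X T"

definition flow_iter :: "'a topology \<Rightarrow> ('a \<Rightarrow> 'a) \<Rightarrow> int \<Rightarrow> 'a \<Rightarrow> 'a" where
  "flow_iter X T n =
     (if 0 \<le> n then T ^^ nat n else inv_into (topspace X) T ^^ nat (- n))"

definition flow_orbit :: "'a topology \<Rightarrow> ('a \<Rightarrow> 'a) \<Rightarrow> 'a \<Rightarrow> 'a set" where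
  "flow_orbit X T x = range (\<lambda>n::int. flow_iter X T n x)"

definition minimal_flow :: "'a topology \<Rightarrow> ('a \<Rightarrow> 'a) \<Rightarrow> bool" where
  "minimal_flow X T \<longleftrightarrow>
     flow X T \<and> (\<forall>x \<in> topspace X. X closure_of flow_orbit X T x = topspace X)"

definition borel_of :: "'a topology \<Rightarrow> 'a measure" where
  "borel_of X = sigma (topspace X) {U. openin X U}"

definition invariant_borel_prob :: "'a topology \<Rightarrow> ('a \<Rightarrow> 'a) \<Rightarrow> 'a measure \<Rightarrow> bool" where
  "invariant_borel_prob X T M \<longleftrightarrow>
     space M = topspace X \<and> sets M = sets (borel_of X) \<and> emeasure M (topspace X) = 1 \<and>
     (\<forall>A \<in> sets M. emeasure M (T -` A \<inter> topspace X) = emeasure M A)"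

definition strictly_ergodic_flow :: "'a topology \<Rightarrow> ('a \<Rightarrow> 'a) \<Rightarrow> bool" where
  "strictly_ergodic_flow X T \<longleftrightarrow>
     minimal_flow X T \<and> (\<exists>!M. invariant_borel_prob X T M)"

definition metric_flow :: "'a topology \<Rightarrow> ('a \<Rightarrow> 'a) \<Rightarrow> bool" where
  "metric_flow X T \<longleftrightarrow> flow X T \<and> metrizable_space X"

text \<open>
  Compatible metrics on a compact space are uniformly equivalent, so distality does not depend on
  the compatible metric chosen.
\<close>

definition distal_flow :: "'a topology \<Rightarrow> ('a \<Rightarrow> 'a) \<Rightarrow> bool" where
  "distal_flow X T \<longleftrightarrow>
     metric_flow X T \<and>
     (\<exists>d. Metric_space (topspace X) d \<and> Metric_space.mtopology (topspace X) d = X \<and>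
        (\<forall>x \<in> topspace X. \<forall>y \<in> topspace X. x \<noteq> y \<longrightarrow>
           (INF n::int. d (flow_iter X T n x) (flow_iter X T n y)) > 0))"

text \<open>
  The space of the join \<open>(X, x, S) \<or> (Y, y, T)\<close> of pointed flows; the acting map is
  \<open>map_prod S T\<close>.
\<close>

definition join_space ::
  "'a topology \<Rightarrow> 'a \<Rightarrow> ('a \<Rightarrow> 'a) \<Rightarrow> 'b topology \<Rightarrow> 'b \<Rightarrow> ('b \<Rightarrow> 'b) \<Rightarrow> ('a \<times> 'b) topology" where
  "join_space X x S Y y T =
     subtopology (prod_topology X Y)
       (prod_topology X Y closure_of flow_orbit (prod_topology X Y) (map_prod S T) (x, y))"

end

theory Submission
  imports Defs "HOL-Probability.Probability" "HOL-Number_Theory.Cong"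
begin

text \<open>
  The flow \<open>W\<close> is a circle extension of a rotation. The base is the profinite group \<open>\<Prod>i. \<int>/p i\<close> for
  pairwise coprime moduli \<open>p i\<close>, with the map \<open>x \<mapsto> x + 1\<close>, and the fibre coordinate moves by
  \<open>t \<mapsto> t + \<alpha> + \<psi> x\<close> where \<open>\<alpha>\<close> is irrational and \<open>\<psi> x = (\<Sum>i. G i (x i + 1) - G i (x i))\<close>. Each
  \<open>G i\<close> is a tent on \<open>\<int>/p i\<close> of height 1, of tiny slope, and supported on a set of tiny density. Thus \<open>\<psi>\<close> is
  continuous, and it is the coboundary \<open>g (x + 1) - g x\<close> of the function \<open>g x = (\<Sum>i. G i (x i))\<close>,
  which exists almost everywhere by the Borel-Cantelli lemma (\<open>AE_summable_G\<close>).

  \<^emph>\<open>W is strictly ergodic.\<close> The moduli grow so fast that at suitable times \<open>n\<close>, multiples of the first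
  \<open>k\<close> moduli, the sums of \<open>\<psi>\<close> along orbits are uniformly small, whereas \<open>n * \<alpha>\<close> approximates any
  prescribed number modulo 1. So all rotations of the fibres are limits of powers of the flow
  (\<open>Phi_rigid\<close>), and every invariant measure is invariant under them. Its marginal on the base is Haar
  measure by the Chinese remainder theorem (\<open>haar_unique\<close>). These two properties determine the
  measure (\<open>invariant_formula\<close>). Distality is clear for an isometric extension of an isometry.

  \<^emph>\<open>The joining.\<close> Take two points of \<open>W\<close> whose base points differ by an element \<open>beta\<close> with
  \<open>beta i\<close> the width of the tent \<open>G i\<close>. The constant \<open>\<alpha>\<close> cancels in the difference of the two fibre
  coordinates, which therefore moves by a coboundary of \<open>D x = g (x + beta) - g x\<close>. Measurably, the
  joining splits into the invariant sets where this difference is \<open>D x + c\<close>, and each of them carries an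
  invariant measure (\<open>graph_measure_invariant\<close>, \<open>graph_measure_distinct\<close>). Topologically nothing splits:
  the \<open>i\<close>-th summand of \<open>D\<close> takes values throughout \<open>[0,1]\<close> on a rarely visited part of \<open>\<int>/p i\<close>, so the
  difference of the fibre coordinates can be steered anywhere by a Chinese remainder argument, and \<open>\<alpha>\<close>
  takes care of the common part (\<open>steering\<close>). Hence the orbit closure consists of all pairs of points
  with base points differing by \<open>beta\<close>, and it is minimal (\<open>J_orbit_dense\<close>).
\<close>

section \<open>Integer actions on compact metric spaces\<close>

text \<open>
  The flow iterates of the definitions go through an inverse function; presenting a flow by a whole
  \<open>\<int>\<close>-indexed family of maps replaces them by a closed formula on \<open>K\<close>.
\<close>

locale int_action =
  fixes K :: "'a::metric_space set" and F :: "int \<Rightarrow> 'a \<Rightarrow> 'a"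
  assumes compact: "compact K"
    and maps: "u \<in> K \<Longrightarrow> F n u \<in> K"
    and zero: "u \<in> K \<Longrightarrow> F 0 u = u"
    and add: "u \<in> K \<Longrightarrow> F (m + n) u = F m (F n u)"
    and cont: "continuous_on K (F n)"
begin

lemma homeomorphic_maps: "homeomorphic_maps (top_of_set K) (top_of_set K) (F 1) (F (-1))"
proof -
  have "F (-1) (F 1 u) = u" "F 1 (F (-1) u) = u" if "u \<in> K" for u
    using that add[of u "-1" 1] add[of u 1 "-1"] zero by auto
  then show ?thesis
    using cont maps by (auto simp: homeomorphic_maps_def)
qed

lemma flow: "flow (top_of_set K) (F 1)"
  using compact homeomorphic_maps
  by (auto simp: flow_def compact_space_subtopology homeomorphic_maps_map
      intro!: Hausdorff_space_subtopology)

lemma metric_flow: "metric_flow (top_of_set K) (F 1)"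
  using flow by (simp add: metric_flow_def metrizable_space_subtopology metrizable_space_euclidean)

lemma iter_pos: "u \<in> K \<Longrightarrow> (F 1 ^^ n) u = F (int n) u"
proof (induction n)
  case (Suc n)
  then show ?case using add[of u 1 "int n"] by simp
qed (simp add: zero)

lemma inv_into_F: "u \<in> K \<Longrightarrow> inv_into K (F 1) u = F (-1) u"
proof -
  assume u: "u \<in> K"
  have "inj_on (F 1) K"
    by (rule inj_on_inverseI[where g="F (-1)"]) (metis add add.left_inverse zero)
  moreover have "F 1 (F (-1) u) = u" using u add[of u 1 "-1"] zero by auto
  ultimately show ?thesis using u maps by (metis inv_into_f_f)
qed

lemma iter_neg: "u \<in> K \<Longrightarrow> (inv_into K (F 1) ^^ n) u = F (- int n) u"
proof (induction n)
  case (Suc n)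
  then show ?case using add[of u "-1" "- int n"] by (simp add: inv_into_F maps)
qed (simp add: zero)

lemma flow_iter_eq: "u \<in> K \<Longrightarrow> flow_iter (top_of_set K) (F 1) n u = F n u"
  by (auto simp: flow_iter_def iter_pos iter_neg)

lemma flow_orbit_eq: "u \<in> K \<Longrightarrow> flow_orbit (top_of_set K) (F 1) u = range (\<lambda>n. F n u)"
  by (auto simp: flow_orbit_def flow_iter_eq)

lemma orbit_closure_eq:
  assumes J: "closed J" "J \<subseteq> K" and a: "a \<in> J" and inv: "\<And>n. F n a \<in> J"
    and dense: "\<And>b. b \<in> J \<Longrightarrow> \<exists>ns. (\<lambda>k. F (ns k) a) \<longlonglongrightarrow> b"
  shows "top_of_set K closure_of flow_orbit (top_of_set K) (F 1) a = J"
proof -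
  let ?O = "range (\<lambda>n. F n a)"
  have "closure ?O \<subseteq> J" using J inv by (intro closure_minimal) auto
  moreover have "b \<in> closure ?O" if b: "b \<in> J" for b
  proof -
    obtain ns where "(\<lambda>k. F (ns k) a) \<longlonglongrightarrow> b" using dense b by blast
    then show ?thesis unfolding closure_sequential by (intro exI[of _ "\<lambda>k. F (ns k) a"]) auto
  qed
  ultimately have "closure ?O = J" by auto
  moreover have "?O \<subseteq> K" using a J maps by auto
  ultimately show ?thesis
    using a J by (auto simp: flow_orbit_eq closure_of_subtopology Int_absorb1 subsetD)
qed

lemma minimal_flowI:
  assumes "\<And>a b. a \<in> K \<Longrightarrow> b \<in> K \<Longrightarrow> \<exists>ns. (\<lambda>k. F (ns k) a) \<longlonglongrightarrow> b"
  shows "minimal_flow (top_of_set K) (F 1)"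
  unfolding minimal_flow_def
proof (intro conjI flow ballI)
  fix a assume "a \<in> topspace (top_of_set K)"
  then show "top_of_set K closure_of flow_orbit (top_of_set K) (F 1) a = topspace (top_of_set K)"
    using assms by (simp add: orbit_closure_eq compact_imp_closed[OF compact] maps)
qed

text \<open>
  On a compact set continuous maps are uniformly continuous, so a pair of points is kept apart by the
  flow as soon as its images under one continuous map are.
\<close>

lemma distal_flowI:
  fixes g :: "'i \<Rightarrow> 'a \<Rightarrow> 'b::metric_space"
  assumes g: "\<And>i. continuous_on K (g i)"
    and sep: "\<And>u v. u \<in> K \<Longrightarrow> v \<in> K \<Longrightarrow> u \<noteq> v \<Longrightarrow> \<exists>i. \<exists>c>0. \<forall>n. c \<le> dist (g i (F n u)) (g i (F n v))"
  shows "distal_flow (top_of_set K) (F 1)"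
  unfolding distal_flow_def
proof (intro conjI metric_flow exI[of _ dist] ballI impI)
  interpret Submetric UNIV dist K by unfold_locales auto
  show "Metric_space (topspace (top_of_set K)) dist"
    by (simp add: sub.Metric_space_axioms)
  show "Metric_space.mtopology (topspace (top_of_set K)) dist = top_of_set K"
    using mtopology_submetric by simp
  fix u v assume uv: "u \<in> topspace (top_of_set K)" "v \<in> topspace (top_of_set K)" "u \<noteq> v"
  then obtain i c where c: "c > 0" "\<And>n. c \<le> dist (g i (F n u)) (g i (F n v))"
    using sep[of u v] by auto
  have "uniformly_continuous_on K (g i)"
    using g compact by (rule compact_uniformly_continuous)
  then obtain d where d: "d > 0"
    "\<And>x y. x \<in> K \<Longrightarrow> y \<in> K \<Longrightarrow> dist x y < d \<Longrightarrow> dist (g i x) (g i y) < c"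
    using c(1) unfolding uniformly_continuous_on_def by metis
  have "d \<le> dist (F n u) (F n v)" for n
    using d(2)[of "F n u" "F n v"] c(2)[of n] uv maps by fastforce
  then have "d \<le> (INF n. dist (flow_iter (top_of_set K) (F 1) n u) (flow_iter (top_of_set K) (F 1) n v))"
    using uv by (intro cINF_greatest) (auto simp: flow_iter_eq)
  then show "0 < (INF n. dist (flow_iter (top_of_set K) (F 1) n u) (flow_iter (top_of_set K) (F 1) n v))"
    using d(1) by linarith
qed

lemma measurable_F:
  "F n \<in> measurable (restrict_space borel K) (restrict_space borel K)"
  using borel_measurable_continuous_on_restrict[OF cont] maps
  by (intro measurable_restrict_space2) (auto simp: space_restrict_space)

end

section \<open>Measure-theoretic tools\<close>

lemma sets_borel_of_top_of_set:
  "sets (borel_of (top_of_set K)) = sets (restrict_space borel K)"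
proof -
  have "sets (borel_of (top_of_set K)) = sigma_sets K {U. openin (top_of_set K) U}"
    unfolding borel_of_def by (subst sets_measure_of) (auto dest: openin_imp_subset)
  also have "{U. openin (top_of_set K) U} = {(\<lambda>x. x) -` S \<inter> K |S. S \<in> Collect open}"
    by (auto simp: openin_open)
  also have "sigma_sets K \<dots> = {(\<lambda>x. x) -` S \<inter> K |S. S \<in> sigma_sets UNIV (Collect open)}"
    by (rule sigma_sets_vimage_commute[symmetric]) simp
  also have "\<dots> = sets (restrict_space borel K)"
    by (auto simp: sets_restrict_space borel_def)
  finally show ?thesis .
qed

text \<open>
  The indicator of a closed set is the decreasing limit of the functions
  \<open>max 0 (1 - m * infdist x C)\<close>, and the closed sets form a generator stable under intersection.
\<close>

lemma borel_measure_eqI_continuous: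
  fixes M N :: "'a::metric_space measure"
  assumes fin: "finite_measure M" "finite_measure N"
    and sets: "sets M = sets borel" "sets N = sets borel"
    and eq: "\<And>f :: 'a \<Rightarrow> real. continuous_on UNIV f \<Longrightarrow> (\<And>x. \<bar>f x\<bar> \<le> 1) \<Longrightarrow>
      (\<integral>x. f x \<partial>M) = (\<integral>x. f x \<partial>N)"
  shows "M = N"
proof -
  interpret M: finite_measure M by fact
  interpret N: finite_measure N by fact
  have lim: "(\<lambda>m. \<integral>x. max 0 (1 - real m * infdist x C) \<partial>L) \<longlonglongrightarrow> measure L C"
    if C: "closed C" "C \<noteq> {}" and L: "finite_measure L" "sets L = sets borel" for C and L :: "'a measure"
  proof -
    interpret finite_measure L by fact
    have "(\<lambda>m. \<integral>x. max 0 (1 - real m * infdist x C) \<partial>L) \<longlonglongrightarrow> (\<integral>x. indicator C x \<partial>L)"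
    proof (rule integral_dominated_convergence[where w="\<lambda>_. 1"])
      have "(\<lambda>m. max 0 (1 - real m * infdist x C)) \<longlonglongrightarrow> (indicator C x :: real)" for x
      proof (cases "x \<in> C")
        case True
        then show ?thesis using C by (simp add: infdist_zero)
      next
        case False
        then have d: "infdist x C > 0" using C by (metis infdist_pos_not_in_closed)
        obtain m0 :: nat where m0: "1 / infdist x C < real m0" using reals_Archimedean2 by blast
        have "max 0 (1 - real m * infdist x C) = 0" if "m \<ge> m0" for m
        proof -
          have "1 / infdist x C < real m" using m0 that by linarith
          then have "1 < real m * infdist x C" using d by (simp add: field_simps)
          then show ?thesis by simp
        qed
        then have "eventually (\<lambda>m. max 0 (1 - real m * infdist x C) = 0) sequentially"
          by (auto simp: eventually_sequentially)
        then show ?thesis using False by (simp add: tendsto_eventually)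
      qed
      then show "AE x in L. (\<lambda>m. max 0 (1 - real m * infdist x C)) \<longlonglongrightarrow> (indicator C x :: real)"
        by simp
      show "AE x in L. norm (max 0 (1 - real m * infdist x C)) \<le> 1" for m
        by (auto simp: infdist_nonneg)
      show "(\<lambda>x. max 0 (1 - real m * infdist x C)) \<in> borel_measurable L" for m
        using L(2) by (auto simp: measurable_cong_sets[OF L(2) refl]
            intro!: borel_measurable_continuous_onI continuous_intros)
      show "indicator C \<in> borel_measurable L" using C L(2) by (intro borel_measurable_indicator) auto
    qed simp
    then show ?thesis using C L by simp
  qed
  show ?thesis
  proof (rule measure_eqI_generator_eq[where E="Collect closed" and \<Omega>=UNIV and A="\<lambda>_. UNIV"])
    show "Int_stable (Collect closed :: 'a set set)" by (auto simp: Int_stable_def)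
    show "sets M = sigma_sets UNIV (Collect closed)" "sets N = sigma_sets UNIV (Collect closed)"
      using sets by (simp_all add: borel_eq_closed)
    fix C :: "'a set" assume C: "C \<in> Collect closed"
    show "emeasure M C = emeasure N C"
    proof (cases "C = {}")
      case False
      have "(\<integral>x. max 0 (1 - real m * infdist x C) \<partial>M) = (\<integral>x. max 0 (1 - real m * infdist x C) \<partial>N)" for m
        by (rule eq) (auto simp: infdist_nonneg intro!: continuous_intros)
      then have "measure M C = measure N C"
        using lim[of C M] lim[of C N] C False fin sets by (auto intro: LIMSEQ_unique)
      then show ?thesis by (simp add: M.emeasure_eq_measure N.emeasure_eq_measure)
    qed simp
  qed auto
qed

text \<open>
  Lebesgue measure of the circle \<open>\<real>/\<int>\<close>, carried by the fundamental domain \<open>[0,1)\<close> so that functions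
  on the circle can be handled as 1-periodic functions of a real variable.
\<close>

definition circle_measure :: "real measure" where
  "circle_measure = density lborel (indicator {0..<1})"

lemma sets_circle_measure [measurable_cong, simp]: "sets circle_measure = sets borel"
  by (simp add: circle_measure_def)

lemma space_circle_measure [simp]: "space circle_measure = UNIV"
  by (simp add: circle_measure_def)

lemma prob_space_circle_measure: "prob_space circle_measure"
  by (rule prob_spaceI) (simp add: circle_measure_def emeasure_density)

lemma nn_integral_circle_shift:
  fixes f :: "real \<Rightarrow> ennreal"
  assumes [measurable]: "f \<in> borel_measurable borel"
    and per: "\<And>t (h::int). f (t + of_int h) = f t"
  shows "(\<integral>\<^sup>+t. f (t + c) \<partial>circle_measure) = (\<integral>\<^sup>+t. f t \<partial>circle_measure)"
proof -
  define a where "a = frac c"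
  have a: "0 \<le> a" "a < 1" by (auto simp: a_def frac_lt_1)
  have fa: "f (t + c) = f (t + a)" for t
    using per[of "t + a" "\<lfloor>c\<rfloor>"] by (simp add: a_def frac_def)
  have fa1: "f (t + a) = f (t + (a - 1))" for t
    using per[of "t + (a - 1)" 1] by (simp add: algebra_simps)
  have "(\<integral>\<^sup>+t. f (t + c) \<partial>circle_measure) = (\<integral>\<^sup>+t. f (t + a) * indicator {0..<1} t \<partial>lborel)"
    by (simp add: circle_measure_def nn_integral_density fa mult.commute)
  also have "\<dots> = (\<integral>\<^sup>+t. f (t + a) * indicator {0..<1-a} t + f (t + (a - 1)) * indicator {1-a..<1} t \<partial>lborel)"
    using a by (intro nn_integral_cong) (auto simp: indicator_def fa1[symmetric])
  also have "\<dots> = (\<integral>\<^sup>+t. f (t + a) * indicator {0..<1-a} t \<partial>lborel) + (\<integral>\<^sup>+t. f (t + (a - 1)) * indicator {1-a..<1} t \<partial>lborel)"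
    by (intro nn_integral_add) auto
  also have "(\<integral>\<^sup>+t. f (t + a) * indicator {0..<1-a} t \<partial>lborel) = (\<integral>\<^sup>+t. f t * indicator {a..<1} t \<partial>lborel)"
    by (subst (2) nn_integral_real_affine[where c=1 and t=a])
      (auto intro!: nn_integral_cong simp: indicator_def add.commute)
  also have "(\<integral>\<^sup>+t. f (t + (a - 1)) * indicator {1-a..<1} t \<partial>lborel) = (\<integral>\<^sup>+t. f t * indicator {0..<a} t \<partial>lborel)"
    by (subst (2) nn_integral_real_affine[where c=1 and t="a - 1"])
      (auto intro!: nn_integral_cong simp: indicator_def add.commute)
  also have "(\<integral>\<^sup>+t. f t * indicator {a..<1} t \<partial>lborel) + (\<integral>\<^sup>+t. f t * indicator {0..<a} t \<partial>lborel)
      = (\<integral>\<^sup>+t. f t * indicator {a..<1} t + f t * indicator {0..<a} t \<partial>lborel)"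
    by (intro nn_integral_add[symmetric]) auto
  also have "\<dots> = (\<integral>\<^sup>+t. f t * indicator {0..<1} t \<partial>lborel)"
    using a by (intro nn_integral_cong) (auto simp: indicator_def)
  also have "\<dots> = (\<integral>\<^sup>+t. f t \<partial>circle_measure)"
    by (simp add: circle_measure_def nn_integral_density mult.commute)
  finally show ?thesis .
qed

abbreviation cyclic_measure :: "nat \<Rightarrow> int measure" where
  "cyclic_measure m \<equiv> measure_pmf (pmf_of_set {0..<int m})"

lemma map_pmf_cyclic:
  assumes "m > 0"
  shows "map_pmf (\<lambda>b. (a + b) mod int m) (pmf_of_set {0..<int m}) = pmf_of_set {0..<int m}"
proof -
  have "inj_on (\<lambda>b. (a + b) mod int m) {0..<int m}"
  proof
    fix x y assume xy: "x \<in> {0..<int m}" "y \<in> {0..<int m}" "(a + x) mod int m = (a + y) mod int m"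
    then have "x mod int m = y mod int m"
      by (metis cong_add_lcancel cong_def)
    then show "x = y" using xy by simp
  qed
  moreover have "(\<lambda>b. (a + b) mod int m) ` {0..<int m} \<subseteq> {0..<int m}" using assms by auto
  ultimately have "bij_betw (\<lambda>b. (a + b) mod int m) {0..<int m} {0..<int m}"
    by (simp add: bij_betw_def endo_inj_surj)
  then show ?thesis using assms by (intro map_pmf_of_set_bij_betw) auto
qed

section \<open>Sequences of real coordinates\<close>

lemma tendsto_fun_componentwise:
  fixes f :: "'k \<Rightarrow> 'i \<Rightarrow> 'b::topological_space"
  assumes "\<And>i. ((\<lambda>k. f k i) \<longlongrightarrow> l i) F"
  shows "(f \<longlongrightarrow> l) F"
proof -
  have "limitin (product_topology (\<lambda>_::'i. euclidean :: 'b topology) UNIV) f l F"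
    using assms by (simp add: limitin_componentwise)
  then show ?thesis by (simp add: euclidean_product_topology)
qed

lemma fun_eq_nat3I: "u 0 = v 0 \<Longrightarrow> u (Suc 0) = v (Suc 0) \<Longrightarrow> (\<And>i. u (Suc (Suc i)) = v (Suc (Suc i))) \<Longrightarrow> u = v"
  for u v :: "nat \<Rightarrow> 'b"
  by (metis ext nat.exhaust)

lemma continuous_on_coord: "continuous_on A (\<lambda>u. u k :: real)"
  using continuous_on_product_coordinates by (rule continuous_on_subset) simp

lemma continuous_on_nat3I:
  fixes f :: "'b::topological_space \<Rightarrow> nat \<Rightarrow> real"
  assumes "continuous_on A (\<lambda>u. f u 0)" "continuous_on A (\<lambda>u. f u (Suc 0))"
    "\<And>i. continuous_on A (\<lambda>u. f u (Suc (Suc i)))"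
  shows "continuous_on A f"
proof (rule continuous_on_coordinatewise_then_product)
  fix k show "continuous_on A (\<lambda>u. f u k)" using assms by (metis nat.exhaust)
qed

lemma cos_sin_add_int:
  "cos (2 * pi * (t + of_int h)) = cos (2 * pi * t)" "sin (2 * pi * (t + of_int h)) = sin (2 * pi * t)"
  by (simp_all add: distrib_left cos_add sin_add)

section \<open>Moduli that grow fast enough\<close>

text \<open>
  Kronecker density with a bound on the multiplier that is uniform in the target: it is enough to
  approximate the points of a finite grid.
\<close>

lemma irrational_dense_bounded:
  fixes \<gamma> \<epsilon> :: real
  assumes "\<gamma> \<notin> \<rat>" "\<epsilon> > 0"
  shows "\<exists>J::nat. \<forall>c. \<exists>m\<le>J. \<exists>h::int. \<bar>real m * \<gamma> - c - of_int h\<bar> \<le> \<epsilon>"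
proof -
  obtain k where k: "inverse (real (Suc k)) < \<epsilon> / 2"
    using reals_Archimedean[of "\<epsilon> / 2"] assms(2) by auto
  define n where "n = Suc k"
  have n: "n > 0" "1 / real n < \<epsilon> / 2" using k by (auto simp: n_def inverse_eq_divide)
  have "\<exists>m::nat. \<bar>frac (real m * \<gamma>) - real i / n\<bar> < \<epsilon> / 2" if "i \<le> n" for i
  proof -
    have "0 \<le> real i / n" "real i / n \<le> 1" "0 < \<epsilon> / 2"
      using that n(1) assms(2) by auto
    from Kronecker_approx_1_explicit[OF assms(1) this] show ?thesis by blast
  qed
  then obtain m where m: "\<And>i. i \<le> n \<Longrightarrow> \<bar>frac (real (m i) * \<gamma>) - real i / n\<bar> < \<epsilon> / 2"
    by metis
  show ?thesis
  proof (rule exI[of _ "Max (m ` {..n})"], rule allI)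
    fix c :: real
    define i where "i = nat \<lfloor>frac c * n\<rfloor>"
    have fl: "0 \<le> \<lfloor>frac c * n\<rfloor>" by simp
    have ri: "real i = of_int \<lfloor>frac c * n\<rfloor>" unfolding i_def using fl by simp
    have "frac c * n \<le> n" using frac_lt_1[of c] by (simp add: mult_left_le_one_le)
    then have "real i \<le> n" unfolding ri by linarith
    then have i: "i \<le> n" by simp
    have "\<bar>frac c * n - real i\<bar> \<le> 1" unfolding ri by linarith
    then have "\<bar>(frac c - real i / n) * n\<bar> \<le> 1" using n by (simp add: left_diff_distrib)
    then have "\<bar>frac c - real i / n\<bar> \<le> 1 / n" using n by (simp add: abs_mult pos_le_divide_eq)
    then have "\<bar>frac (real (m i) * \<gamma>) - frac c\<bar> \<le> \<epsilon>"
      using m[OF i] n(2) by linarith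
    then have "\<bar>real (m i) * \<gamma> - c - of_int (\<lfloor>real (m i) * \<gamma>\<rfloor> - \<lfloor>c\<rfloor>)\<bar> \<le> \<epsilon>"
      by (simp add: frac_def)
    moreover have "m i \<le> Max (m ` {..n})" using i by (intro Max_ge) auto
    ultimately show "\<exists>m'\<le>Max (m ` {..n}). \<exists>h::int. \<bar>real m' * \<gamma> - c - of_int h\<bar> \<le> \<epsilon>" by blast
  qed
qed

text \<open>
  The parameters of the construction. At stage \<open>k\<close> all times up to \<open>N k\<close> are available, and some of them
  are multiples of \<open>p 0 \<cdots> p (k - 1)\<close> whose product with \<open>\<alpha>\<close> approximates a prescribed number modulo 1
  (\<open>dens\<close>; the extra summand \<open>\<Prod>i<k. p i\<close> leaves room for adding a solution of congruences
  modulo \<open>p 0, \<dots>, p (k - 1)\<close>).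
  By \<open>grow\<close> the coordinates \<open>i \<ge> k\<close> are still so slow at those times that they can be ignored;
  by \<open>p_large\<close> the supports of the tents \<open>G i\<close> defined below, of width \<open>2 * q i\<close>, have summable density.
\<close>

locale tower =
  fixes \<alpha> :: real and p q N :: "nat \<Rightarrow> nat"
  assumes coprime: "i \<noteq> j \<Longrightarrow> coprime (p i) (p j)"
    and q_pos: "q i > 0"
    and p_large: "2 ^ i * (4 * q i) < p i"
    and grow: "k \<le> i \<Longrightarrow> 2 ^ i * N k \<le> q i"
    and dens: "\<exists>m. (\<Prod>i<k. p i) + m * (\<Prod>i<k. p i) \<le> N k \<and>
      (\<exists>h::int. \<bar>real (m * (\<Prod>i<k. p i)) * \<alpha> - c - of_int h\<bar> \<le> (1/2) ^ k)"

lemma irrational_exists: "\<exists>\<alpha>::real. \<alpha> \<notin> \<rat>"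
proof (rule ccontr)
  assume "\<nexists>\<alpha>::real. \<alpha> \<notin> \<rat>"
  then have "(\<rat> :: real set) = UNIV" by auto
  moreover have "countable (\<rat> :: real set)" by (rule countable_rat)
  ultimately show False using uncountable_UNIV_real by simp
qed

text \<open>
  The numbers are chosen recursively. With \<open>P\<close> the product of the previous moduli, irrationality of
  \<open>P * \<alpha>\<close> provides \<open>N k\<close>; then \<open>q k\<close> is taken to be a large multiple of \<open>P\<close>, and adding 1 to a
  multiple of \<open>q k\<close> produces a modulus coprime to all previous ones.
\<close>

lemma tower_exists: "\<exists>\<alpha> p q N. tower \<alpha> p q N"
proof -
  obtain \<alpha> :: real where \<alpha>: "\<alpha> \<notin> \<rat>" using irrational_exists by blast
  define J where "J P k = (SOME J::nat. \<forall>c. \<exists>m\<le>J. \<exists>h::int.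
    \<bar>real m * (real P * \<alpha>) - c - of_int h\<bar> \<le> (1/2) ^ k)" for P k :: nat
  have J: "\<exists>m\<le>J P k. \<exists>h::int. \<bar>real m * (real P * \<alpha>) - c - of_int h\<bar> \<le> (1/2) ^ k"
    if "P > 0" for P k :: nat and c
  proof -
    have "real P * \<alpha> \<notin> \<rat>"
    proof
      assume "real P * \<alpha> \<in> \<rat>"
      then have "real P * \<alpha> / real P \<in> \<rat>" by (intro Rats_divide) auto
      then show False using \<alpha> that by simp
    qed
    moreover have "(1/2::real) ^ k > 0" by simp
    ultimately have "\<exists>J::nat. \<forall>c. \<exists>m\<le>J. \<exists>h::int. \<bar>real m * (real P * \<alpha>) - c - of_int h\<bar> \<le> (1/2) ^ k"
      by (rule irrational_dense_bounded)
    from someI_ex[OF this] show ?thesis unfolding J_def by blast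
  qed
  define NN where "NN k P = P + J P k * P" for k P
  define PP where "PP = rec_nat 1 (\<lambda>k P. P * (2 ^ (k + 3) * (2 ^ k * NN k P) + 1))"
  define N where "N k = NN k (PP k)" for k
  define q where "q k = 2 ^ k * N k" for k
  define p where "p k = 2 ^ (k + 3) * q k + 1" for k
  have PP0: "PP 0 = 1" and PPS: "PP (Suc k) = PP k * p k" for k
    by (simp_all add: PP_def p_def q_def N_def)
  have PP: "PP k = (\<Prod>i<k. p i)" for k
    by (induction k) (simp_all add: PP0 PPS mult.commute)
  have PPpos: "PP k > 0" for k by (simp add: PP p_def prod_pos)
  have N_ge: "PP k \<le> N k" for k by (simp add: N_def NN_def)
  have q_ge: "N k \<le> q k" for k by (simp add: q_def)
  have p_ge: "q k \<le> p k" for k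
  proof -
    have "1 * q k \<le> 2 ^ (k + 3) * q k" by (intro mult_right_mono) auto
    then show ?thesis unfolding p_def by linarith
  qed
  have N_mono: "N k \<le> N (Suc k)" for k
  proof -
    have "N k \<le> p k" using q_ge p_ge by (rule order_trans)
    also have "p k \<le> PP (Suc k)" using PPpos[of k] by (simp add: PPS)
    also have "\<dots> \<le> N (Suc k)" by (rule N_ge)
    finally show ?thesis .
  qed
  have "tower \<alpha> p q N"
  proof
    have cop: "coprime (p i) (p j)" if "i < j" for i j
    proof -
      have "PP j dvd N j" by (simp add: N_def NN_def)
      then have "PP j dvd 2 ^ (j + 3) * q j" by (simp add: q_def)
      then have "coprime (PP j) (p j)"
        unfolding p_def by (metis coprime_Suc_right_nat coprime_divisors dvd_refl Suc_eq_plus1)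
      moreover have "p i dvd PP j" unfolding PP using that by (intro dvd_prodI) auto
      ultimately show ?thesis by (meson coprime_divisors dvd_refl)
    qed
    show "coprime (p i) (p j)" if "i \<noteq> j" for i j
      using cop[of i j] cop[of j i] that by (auto simp: coprime_commute neq_iff)
    show "0 < q i" for i using PPpos[of i] N_ge[of i] q_ge[of i] by linarith
    show "2 ^ i * (4 * q i) < p i" for i by (simp add: p_def power_add)
    show "2 ^ i * N k \<le> q i" if "k \<le> i" for k i
      using lift_Suc_mono_le[of N, OF N_mono that] by (simp add: q_def)
    show "\<exists>m. (\<Prod>i<k. p i) + m * (\<Prod>i<k. p i) \<le> N k \<and>
      (\<exists>h::int. \<bar>real (m * (\<Prod>i<k. p i)) * \<alpha> - c - of_int h\<bar> \<le> (1/2) ^ k)" for k c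
      using J[OF PPpos[of k], of k c]
      by (auto simp: N_def NN_def PP[symmetric] mult.assoc intro!: mult_right_mono)
  qed
  then show ?thesis by blast
qed

context tower
begin

lemma p_pos [simp]: "p i > 0"
  using p_large[of i] by linarith

lemma N_pos: "N k > 0"
proof -
  have "(\<Prod>i<k. p i) > 0" by (simp add: prod_pos)
  then show ?thesis using dens[of k 0] by linarith
qed

lemma four_q_less_p: "4 * int (q i) < int (p i)"
proof -
  have "1 * (4 * q i) \<le> 2 ^ i * (4 * q i)" by (intro mult_right_mono) auto
  then show ?thesis using p_large[of i] by linarith
qed

lemma inverse_q_le:
  assumes "k \<le> i"
  shows "real (N k) / q i \<le> (1/2) ^ i"
proof -
  have "real (2 ^ i * N k) \<le> real (q i)" using grow[OF assms] of_nat_le_iff by blast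
  then show ?thesis using q_pos[of i] by (simp add: field_simps)
qed

text \<open>
  A tent of height 1 on \<open>\<int>/p i\<close>, supported in \<open>(0, 2 * q i)\<close> and with slopes \<open>\<plusminus>1 / q i\<close>.
\<close>

definition G :: "nat \<Rightarrow> int \<Rightarrow> real" where
  "G i j = max 0 (1 - \<bar>of_int (j mod int (p i)) - real (q i)\<bar> / real (q i))"

lemma G_cong: "j mod int (p i) = j' mod int (p i) \<Longrightarrow> G i j = G i j'"
  by (simp add: G_def)

lemma G_mod [simp]: "G i (j mod int (p i)) = G i j"
  by (simp add: G_def)

lemma G_eq_0: "j mod int (p i) = 0 \<or> 2 * int (q i) \<le> j mod int (p i) \<Longrightarrow> G i j = 0"
proof -
  assume "j mod int (p i) = 0 \<or> 2 * int (q i) \<le> j mod int (p i)"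
  then have "j mod int (p i) = 0 \<or> 2 * real (q i) \<le> of_int (j mod int (p i))"
    by linarith
  then show ?thesis using q_pos[of i] by (auto simp: G_def field_simps)
qed

lemma G_linear: "0 \<le> j \<Longrightarrow> j \<le> int (q i) \<Longrightarrow> G i j = of_int j / q i"
  using four_q_less_p[of i] q_pos[of i] by (simp add: G_def field_simps)

lemma G_step: "\<bar>G i (j + 1) - G i j\<bar> \<le> 1 / q i"
proof -
  define r where "r = j mod int (p i)"
  have r: "0 \<le> r" "r < p i" by (auto simp: r_def)
  have j: "G i j = G i r" "G i (j + 1) = G i (r + 1)"
    by (auto intro!: G_cong simp: r_def mod_add_left_eq)
  show ?thesis
  proof (cases "r + 1 = p i")
    case True
    then have "G i (r + 1) = 0" by (intro G_eq_0) simp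
    moreover have "G i r = 0" using four_q_less_p[of i] True r by (intro G_eq_0) simp
    ultimately show ?thesis unfolding j by simp
  next
    case False
    then have m: "r mod int (p i) = r" "(r + 1) mod int (p i) = r + 1" using r by auto
    have "G i (r + 1) = max 0 (1 - \<bar>of_int r + 1 - real (q i)\<bar> / real (q i))"
      "G i r = max 0 (1 - \<bar>of_int r - real (q i)\<bar> / real (q i))"
      unfolding G_def m by simp_all
    moreover have "\<bar>max 0 (1 - a) - max 0 (1 - b)\<bar> \<le> \<bar>b - a\<bar>" for a b :: real by linarith
    moreover have "\<bar>\<bar>of_int r - real (q i)\<bar> / real (q i) - \<bar>of_int r + 1 - real (q i)\<bar> / real (q i)\<bar>
       = \<bar>\<bar>of_int r - real (q i)\<bar> - \<bar>of_int r + 1 - real (q i)\<bar>\<bar> / real (q i)"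
      by (simp flip: diff_divide_distrib)
    moreover have "\<dots> \<le> 1 / real (q i)" by (intro divide_right_mono) auto
    ultimately show ?thesis unfolding j by (metis order_trans)
  qed
qed

lemma G_lipschitz_nat: "\<bar>G i (j + int n) - G i j\<bar> \<le> real n / q i"
proof (induction n)
  case (Suc n)
  have "\<bar>G i (j + int (Suc n)) - G i j\<bar> \<le> \<bar>G i (j + int n + 1) - G i (j + int n)\<bar> + \<bar>G i (j + int n) - G i j\<bar>"
    by (simp add: algebra_simps)
  also have "\<dots> \<le> 1 / q i + real n / q i" using Suc G_step by (intro add_mono) auto
  finally show ?case by (simp add: add_divide_distrib)
qed simp

lemma G_lipschitz: "\<bar>G i (j + n) - G i j\<bar> \<le> \<bar>of_int n\<bar> / q i"
proof (cases "n \<ge> 0")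
  case True
  then show ?thesis using G_lipschitz_nat[of i j "nat n"] by simp
next
  case False
  then show ?thesis using G_lipschitz_nat[of i "j + n" "nat (- n)"] by simp
qed

lemma q_ge_power: "2 ^ i \<le> real (q i)"
proof -
  have "2 ^ i * 1 \<le> 2 ^ i * N i" using N_pos[of i] by (intro mult_left_mono) auto
  then have "2 ^ i \<le> q i" using grow[of i i] by linarith
  then show ?thesis by (metis of_nat_le_iff of_nat_numeral of_nat_power)
qed

lemma G_lipschitz_power: "\<bar>G i (j + n) - G i j\<bar> \<le> \<bar>of_int n\<bar> * (1/2) ^ i"
proof -
  have "\<bar>of_int n\<bar> / real (q i) \<le> \<bar>of_int n\<bar> / 2 ^ i"
    using q_ge_power[of i] q_pos[of i] by (intro divide_left_mono) auto
  then show ?thesis using G_lipschitz[of i j n] by (simp add: power_divide)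
qed

text \<open>
  This is the cocycle over \<open>x \<mapsto> x + 1\<close> with formal transfer function \<open>g x = (\<Sum>i. G i (x i))\<close>. Its series
  converges uniformly in \<open>x\<close> because the tents have small slopes, whereas that of \<open>g\<close> does not.
\<close>

definition Psi :: "int \<Rightarrow> (nat \<Rightarrow> int) \<Rightarrow> real" where
  "Psi n x = (\<Sum>i. G i (x i + n) - G i (x i))"

lemma summable_Psi: "summable (\<lambda>i. G i (x i + n) - G i (x i))"
  by (rule summable_comparison_test'[where g="\<lambda>i. \<bar>of_int n\<bar> * (1/2) ^ i" and N=0])
    (auto simp: G_lipschitz_power intro!: summable_mult summable_geometric)

lemma Psi_0 [simp]: "Psi 0 x = 0"
  by (simp add: Psi_def)

lemma Psi_add: "Psi (m + n) x = Psi m (\<lambda>i. x i + n) + Psi n x"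
  unfolding Psi_def by (subst suminf_add[OF summable_Psi[where x="\<lambda>i. x i + n"] summable_Psi])
    (simp add: algebra_simps)

lemma Psi_cong:
  assumes "\<And>i. x i mod int (p i) = y i mod int (p i)"
  shows "Psi n x = Psi n y"
proof -
  have "G i (x i + n) = G i (y i + n)" "G i (x i) = G i (y i)" for i
    using assms[of i] by (auto intro!: G_cong mod_add_cong)
  then show ?thesis by (simp add: Psi_def)
qed

lemma Psi_tail:
  assumes n: "n \<le> N k"
  shows "\<bar>Psi (int n) x - (\<Sum>i<k. G i (x i + int n) - G i (x i))\<bar> \<le> 2 * (1/2) ^ k"
proof -
  let ?f = "\<lambda>i. G i (x i + int n) - G i (x i)"
  have b: "norm (?f (i + k)) \<le> (1/2) ^ k * (1/2) ^ i" for i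
  proof -
    have "\<bar>?f (i + k)\<bar> \<le> real n / q (i + k)" by (rule G_lipschitz_nat)
    also have "\<dots> \<le> real (N k) / q (i + k)" using n by (intro divide_right_mono) auto
    also have "\<dots> \<le> (1/2) ^ (i + k)" by (rule inverse_q_le) simp
    finally show ?thesis by (simp add: power_add mult.commute)
  qed
  have "Psi (int n) x - (\<Sum>i<k. ?f i) = (\<Sum>i. ?f (i + k))"
    unfolding Psi_def using suminf_split_initial_segment[OF summable_Psi, of x "int n" k] by simp
  also have "\<bar>\<dots>\<bar> \<le> (\<Sum>i. (1/2) ^ k * (1/2) ^ i)"
    using norm_suminf_le[OF b summable_mult[OF summable_geometric]] by simp
  also have "\<dots> = 2 * (1/2) ^ k"
    by (subst suminf_mult) (auto simp: suminf_geometric)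
  finally show ?thesis .
qed

text \<open>
  Base points of the two components of the joining will differ by \<open>beta\<close>. A shift by the full width of
  the tent makes \<open>G i (j + beta i) - G i j\<close> run through all values in \<open>[0,1]\<close> up to \<open>1 / q i\<close>, on a
  small part of \<open>\<int>/p i\<close> only.
\<close>

definition beta :: "nat \<Rightarrow> int" where
  "beta i = 2 * int (q i)"

lemma chinese_remainder:
  "\<exists>n::nat. n < (\<Prod>i<k. p i) \<and> (\<forall>i<k. int n mod int (p i) = u i mod int (p i))"
proof -
  obtain n where n: "n < (\<Prod>i<k. p i)" "\<And>i. i < k \<Longrightarrow> [n = nat (u i mod int (p i))] (mod p i)"
    using chinese_remainder_unique_nat[of "{..<k}" p "\<lambda>i. nat (u i mod int (p i))"] coprime
    by auto
  have "int n mod int (p i) = u i mod int (p i)" if "i < k" for i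
  proof -
    have "[int n = int (nat (u i mod int (p i)))] (mod int (p i))"
      using n(2)[OF that] by (simp only: cong_int_iff)
    then show ?thesis by (simp add: cong_def)
  qed
  then show ?thesis using n(1) by blast
qed

lemma G_difference_dense:
  assumes "0 \<le> v" "v < 1"
  shows "\<exists>j. \<bar>G i (j + beta i) - G i j - v\<bar> \<le> (1/2) ^ i"
proof -
  define b where "b = \<lfloor>v * q i\<rfloor>"
  have q: "real (q i) > 0" using q_pos by simp
  have "v * q i < q i" using assms q by simp
  then have b: "0 \<le> b" "b < int (q i)" using assms q by (simp_all add: b_def floor_less_iff)
  have "(b - beta i) mod int (p i) = (int (p i) + b - beta i) mod int (p i)"
    by (metis add_diff_eq mod_add_self1)
  also have "\<dots> = int (p i) + b - beta i"
    using b four_q_less_p[of i] by (intro mod_pos_pos_trivial) (auto simp: beta_def)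
  finally have "G i (b - beta i) = 0"
    using b four_q_less_p[of i] by (intro G_eq_0) (auto simp: beta_def)
  moreover have "G i b = b / q i" using b by (intro G_linear) auto
  moreover have "\<bar>b / q i - v\<bar> \<le> 1 / q i"
  proof -
    have "\<bar>of_int b - v * q i\<bar> \<le> 1" unfolding b_def by linarith
    then have "\<bar>(b / q i - v) * q i\<bar> \<le> 1" using q by (simp add: left_diff_distrib)
    then show ?thesis using q by (simp add: abs_mult pos_le_divide_eq)
  qed
  moreover have "1 / real (q i) \<le> (1/2) ^ i"
    using q_ge_power[of i] q by (simp add: power_divide divide_left_mono)
  ultimately show ?thesis by (intro exI[of _ "b - beta i"]) auto
qed

text \<open>
  The lemma behind minimality. Two base points at distance \<open>beta\<close> carry fibre coordinates \<open>t\<close> and \<open>s\<close>.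
  The residues of the time \<open>n\<close> modulo \<open>p i\<close> for \<open>i < k\<close> move the base point to \<open>y\<close>, the residue modulo
  \<open>p k\<close> adjusts the difference \<open>s - t\<close>, and adding a multiple of the product of all these moduli
  adjusts \<open>t\<close> through \<open>\<alpha>\<close>, which acts on both fibres alike. The coordinates beyond \<open>k\<close> contribute a
  small error.
\<close>

lemma steering:
  "\<exists>n::nat. (\<forall>i<k. (x i + int n) mod int (p i) = y i mod int (p i)) \<and>
     (\<exists>h::int. \<bar>t + n * \<alpha> + Psi (int n) x - t' - of_int h\<bar> \<le> 3 * (1/2) ^ k) \<and>
     (\<exists>h::int. \<bar>s + n * \<alpha> + Psi (int n) (\<lambda>i. x i + beta i) - s' - of_int h\<bar> \<le> 3 * (1/2) ^ k)"
proof -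
  define C where "C = (\<Sum>i<k. (G i (y i + beta i) - G i (x i + beta i)) - (G i (y i) - G i (x i)))
    - (G k (x k + beta k) - G k (x k))"
  \<comment> \<open>\<open>C\<close> is the change of \<open>s - t\<close> caused by all coordinates up to \<open>k\<close>, except that the final value
    at coordinate \<open>k\<close> is left free; that value has to be \<open>w\<close> modulo 1.\<close>
  define w where "w = (s' - t') - (s - t) - C"
  obtain j where j: "\<bar>G k (j + beta k) - G k j - frac w\<bar> \<le> (1/2) ^ k"
    using G_difference_dense[of "frac w" k] frac_lt_1 by auto
  define u where "u i = (if i < k then y i else j) - x i" for i
  define P where "P = (\<Prod>i<Suc k. p i)"
  obtain n0 where n0: "n0 < P" "\<And>i. i < Suc k \<Longrightarrow> int n0 mod int (p i) = u i mod int (p i)"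
    using chinese_remainder[of "Suc k" u] unfolding P_def by auto
  define z where "z i = (if i < k then y i else j)" for i
  define A where "A = (\<Sum>i<Suc k. G i (z i) - G i (x i))"
  define B where "B = (\<Sum>i<Suc k. G i (z i + beta i) - G i (x i + beta i))"
  obtain m h where m: "P + m * P \<le> N (Suc k)"
    "\<bar>real (m * P) * \<alpha> - (t' - t - A - n0 * \<alpha>) - of_int h\<bar> \<le> (1/2) ^ Suc k"
    using dens[of "Suc k" "t' - t - A - n0 * \<alpha>"] unfolding P_def by blast
  define n where "n = n0 + m * P"
  have nN: "n \<le> N (Suc k)" using m(1) n0(1) by (simp add: n_def)
  have res: "(x i + int n) mod int (p i) = z i mod int (p i)" if i: "i < Suc k" for i
  proof -
    have "p i dvd P" unfolding P_def using i by (intro dvd_prodI) auto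
    then obtain c where "P = p i * c" by (rule dvdE)
    then have "x i + int n = x i + int n0 + int (p i) * int (m * c)" by (simp add: n_def)
    then have "(x i + int n) mod int (p i) = (x i + int n0) mod int (p i)" by (simp only: mod_mult_self2)
    also have "\<dots> = (x i + u i) mod int (p i)" by (rule mod_add_cong[OF refl n0(2)[OF i]])
    finally show ?thesis by (simp add: u_def z_def)
  qed
  have res': "(x i + beta i + int n) mod int (p i) = (z i + beta i) mod int (p i)" if i: "i < Suc k" for i
    using mod_add_cong[OF res[OF i] refl, of "beta i"] by (simp add: ac_simps)
  have PsiA: "\<bar>Psi (int n) x - A\<bar> \<le> (1/2) ^ k"
  proof -
    have "A = (\<Sum>i<Suc k. G i (x i + int n) - G i (x i))"
      unfolding A_def using res by (intro sum.cong refl arg_cong2[where f="(-)"] G_cong) auto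
    then show ?thesis using Psi_tail[OF nN, of x] by simp
  qed
  have PsiB: "\<bar>Psi (int n) (\<lambda>i. x i + beta i) - B\<bar> \<le> (1/2) ^ k"
  proof -
    have "B = (\<Sum>i<Suc k. G i (x i + beta i + int n) - G i (x i + beta i))"
      unfolding B_def using res' by (intro sum.cong refl arg_cong2[where f="(-)"] G_cong) auto
    then show ?thesis using Psi_tail[OF nN, of "\<lambda>i. x i + beta i"] by simp
  qed
  have BA: "B - A = C + (G k (j + beta k) - G k j)"
    unfolding A_def B_def C_def z_def by (simp add: sum_subtractf)
  have t: "\<bar>t + n * \<alpha> + A - t' - of_int h\<bar> \<le> (1/2) ^ Suc k"
    using m(2) by (simp add: n_def algebra_simps)
  have w: "\<bar>(s - t) + (B - A) - (s' - t') + of_int \<lfloor>w\<rfloor>\<bar> \<le> (1/2) ^ k"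
    using j unfolding BA by (simp add: frac_def w_def)
  have half: "(1/2::real) ^ Suc k \<le> (1/2) ^ k" by simp
  have "\<bar>t + n * \<alpha> + Psi (int n) x - t' - of_int h\<bar> \<le> 3 * (1/2) ^ k"
    using t PsiA half by linarith
  moreover have "\<bar>s + n * \<alpha> + Psi (int n) (\<lambda>i. x i + beta i) - s' - of_int (h - \<lfloor>w\<rfloor>)\<bar> \<le> 3 * (1/2) ^ k"
    using t PsiB w half unfolding of_int_diff by linarith
  moreover have "(x i + int n) mod int (p i) = y i mod int (p i)" if "i < k" for i
    using res[of i] that by (simp add: z_def)
  ultimately show ?thesis by blast
qed

text \<open>
  At these times the base is almost back to its initial position and, by the next lemma, the cocycle
  \<open>Psi\<close> is uniformly small, whereas \<open>n * \<alpha>\<close> is arbitrary modulo 1.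
\<close>

lemma rigid_times:
  "\<exists>n::nat. n \<le> N k \<and> (\<forall>i<k. p i dvd n) \<and> (\<exists>h::int. \<bar>n * \<alpha> - c - of_int h\<bar> \<le> (1/2) ^ k)"
proof -
  obtain m h where m: "(\<Prod>i<k. p i) + m * (\<Prod>i<k. p i) \<le> N k"
    "\<bar>real (m * (\<Prod>i<k. p i)) * \<alpha> - c - of_int h\<bar> \<le> (1/2) ^ k"
    using dens[of k c] by blast
  have "p i dvd m * (\<Prod>i<k. p i)" if "i < k" for i
    using that by (intro dvd_mult dvd_prodI) auto
  then show ?thesis using m by (intro exI[of _ "m * (\<Prod>i<k. p i)"]) auto
qed

lemma Psi_rigid:
  assumes "n \<le> N k" "\<And>i. i < k \<Longrightarrow> p i dvd n"
  shows "\<bar>Psi (int n) x\<bar> \<le> 2 * (1/2) ^ k"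
proof -
  have "(x i + int n) mod int (p i) = x i mod int (p i)" if "i < k" for i
    using assms(2)[OF that] by (metis add.right_neutral dvd_imp_mod_0 mod_add_right_eq of_nat_dvd_iff)
  then have "G i (x i + int n) = G i (x i)" if "i < k" for i
    using that by (intro G_cong) auto
  then show ?thesis using Psi_tail[OF assms(1), of x] by simp
qed

section \<open>The flow and its topological self-joining\<close>

text \<open>
  Points of the circle bundle over \<open>\<Prod>i. \<int>/p i\<close>, embedded in a space of real sequences. Arbitrary
  integers \<open>x i\<close> and reals \<open>t\<close> serve as parameters, which makes the action (\<open>Phi_pt\<close>) additive in them.
\<close>

definition pt :: "(nat \<Rightarrow> int) \<Rightarrow> real \<Rightarrow> nat \<Rightarrow> real" where
  "pt x t = (\<lambda>k. case k of 0 \<Rightarrow> cos (2 * pi * t) | Suc 0 \<Rightarrow> sin (2 * pi * t)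
     | Suc (Suc i) \<Rightarrow> of_int (x i mod int (p i)))"

definition base :: "(nat \<Rightarrow> real) \<Rightarrow> nat \<Rightarrow> int" where
  "base u i = \<lfloor>u (Suc (Suc i))\<rfloor>"

text \<open>
  Translation by \<open>n\<close> in the base and by \<open>c\<close> in the fibre, expressed in coordinates as a rotation matrix
  applied to the first two entries.
\<close>

definition act :: "int \<Rightarrow> real \<Rightarrow> (nat \<Rightarrow> real) \<Rightarrow> nat \<Rightarrow> real" where
  "act n c u = (\<lambda>k. case k of
      0 \<Rightarrow> u 0 * cos (2 * pi * c) - u 1 * sin (2 * pi * c)
    | Suc 0 \<Rightarrow> u 1 * cos (2 * pi * c) + u 0 * sin (2 * pi * c)
    | Suc (Suc i) \<Rightarrow> of_int ((base u i + n) mod int (p i)))"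

definition W :: "(nat \<Rightarrow> real) set" where
  "W = {pt x t | x t. True}"

definition Phi :: "int \<Rightarrow> (nat \<Rightarrow> real) \<Rightarrow> nat \<Rightarrow> real" where
  "Phi n u = act n (of_int n * \<alpha> + Psi n (base u)) u"

lemma pt_simps [simp]:
  "pt x t 0 = cos (2 * pi * t)" "pt x t (Suc 0) = sin (2 * pi * t)"
  "pt x t (Suc (Suc i)) = of_int (x i mod int (p i))"
  by (simp_all add: pt_def)

lemma pt_cong:
  assumes "\<And>i. x i mod int (p i) = y i mod int (p i)"
  shows "pt x t = pt y t"
  using assms by (intro fun_eq_nat3I) auto

lemma pt_add_int: "pt x (t + of_int h) = pt x t"
  by (intro fun_eq_nat3I) (auto simp: cos_sin_add_int)

lemma pt_mod [simp]: "pt (\<lambda>i. x i mod int (p i)) t = pt x t"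
  by (rule pt_cong) simp

lemma base_pt [simp]: "base (pt x t) = (\<lambda>i. x i mod int (p i))"
  by (simp add: base_def fun_eq_iff)

lemma pt_in_W [simp]: "pt x t \<in> W"
  by (auto simp: W_def)

lemma W_cases:
  assumes "u \<in> W"
  obtains x t where "u = pt x t"
  using assms by (auto simp: W_def)

lemma act_pt: "act n c (pt x t) = pt (\<lambda>i. x i + n) (t + c)"
  by (intro fun_eq_nat3I) (auto simp: act_def distrib_left cos_add sin_add mod_add_left_eq)

lemma Psi_mod [simp]: "Psi n (\<lambda>i. x i mod int (p i)) = Psi n x"
  by (rule Psi_cong) simp

lemma Phi_pt: "Phi n (pt x t) = pt (\<lambda>i. x i + n) (t + of_int n * \<alpha> + Psi n x)"
  by (simp add: Phi_def act_pt add.assoc)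

lemma Phi_in_W: "u \<in> W \<Longrightarrow> Phi n u \<in> W"
  by (auto elim!: W_cases simp: Phi_pt)

lemma Phi_0: "u \<in> W \<Longrightarrow> Phi 0 u = u"
  by (auto elim!: W_cases simp: Phi_pt)

lemma Phi_add: "u \<in> W \<Longrightarrow> Phi (m + n) u = Phi m (Phi n u)"
  by (auto elim!: W_cases simp: Phi_pt Psi_add algebra_simps)

lemma compact_W: "compact W"
proof -
  define K :: "nat \<Rightarrow> real set" where
    "K k = (case k of 0 \<Rightarrow> {-1..1} | Suc 0 \<Rightarrow> {-1..1} | Suc (Suc i) \<Rightarrow> of_int ` {0..<int (p i)})" for k
  have "compact (K k)" for k
    unfolding K_def by (auto split: nat.split intro: finite_imp_compact)
  then have "compactin (product_topology (\<lambda>_. euclidean) UNIV) (PiE UNIV K)"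
    unfolding compactin_PiE by auto
  then have "compact (Pi UNIV K)"
    by (simp add: euclidean_product_topology PiE_UNIV_domain)
  moreover have "closed {u :: nat \<Rightarrow> real. (u 0)\<^sup>2 + (u (Suc 0))\<^sup>2 = 1}"
    by (intro closed_Collect_eq continuous_intros continuous_on_product_coordinates)
  ultimately have "compact (Pi UNIV K \<inter> {u. (u 0)\<^sup>2 + (u (Suc 0))\<^sup>2 = 1})"
    by (rule compact_Int_closed)
  also have "Pi UNIV K \<inter> {u. (u 0)\<^sup>2 + (u (Suc 0))\<^sup>2 = 1} = W"
  proof (intro equalityI subsetI)
    fix u assume "u \<in> Pi UNIV K \<inter> {u. (u 0)\<^sup>2 + (u (Suc 0))\<^sup>2 = 1}"
    then have K: "\<And>k. u k \<in> K k" and c: "(u 0)\<^sup>2 + (u (Suc 0))\<^sup>2 = 1" by auto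
    obtain t where t: "u 0 = cos t" "u (Suc 0) = sin t" using sincos_total_2pi[OF c] by metis
    have "u (Suc (Suc i)) = of_int (base u i mod int (p i))" for i
      using K[of "Suc (Suc i)"] by (auto simp: K_def base_def)
    then have "u = pt (base u) (t / (2 * pi))" using t by (intro fun_eq_nat3I) auto
    then show "u \<in> W" by (metis pt_in_W)
  next
    fix u assume "u \<in> W"
    then show "u \<in> Pi UNIV K \<inter> {u. (u 0)\<^sup>2 + (u (Suc 0))\<^sup>2 = 1}"
      by (auto elim!: W_cases simp: K_def split: nat.split)
  qed
  finally show ?thesis .
qed

text \<open>
  Every function of a single base coordinate is continuous, as that coordinate takes finitely many
  values on \<open>W\<close>.
\<close>

lemma continuous_on_base:
  fixes f :: "int \<Rightarrow> 'b::topological_space"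
  shows "continuous_on W (\<lambda>u. f (base u i))"
proof -
  have "continuous_on (of_int ` {0..<int (p i)}) (\<lambda>r::real. f \<lfloor>r\<rfloor>)"
    by (intro continuous_on_finite) simp
  moreover have "continuous_on W (\<lambda>u. u (Suc (Suc i)))"
    using continuous_on_product_coordinates by (rule continuous_on_subset) simp
  moreover have "(\<lambda>u. u (Suc (Suc i))) ` W \<subseteq> of_int ` {0..<int (p i)}"
    by (auto elim!: W_cases)
  ultimately show ?thesis
    unfolding base_def by (rule continuous_on_compose2)
qed

lemma continuous_on_Psi: "continuous_on W (\<lambda>u. Psi n (base u))"
proof (rule uniform_limit_theorem)
  show "uniform_limit W (\<lambda>k u. \<Sum>i<k. G i (base u i + n) - G i (base u i)) (\<lambda>u. Psi n (base u)) sequentially"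
    unfolding Psi_def
    by (rule Weierstrass_m_test[where M="\<lambda>i. \<bar>of_int n\<bar> * (1/2) ^ i"])
      (auto simp: G_lipschitz_power intro!: summable_mult summable_geometric)
  show "\<forall>\<^sub>F k in sequentially. continuous_on W (\<lambda>u. \<Sum>i<k. G i (base u i + n) - G i (base u i))"
    by (intro always_eventually allI continuous_on_sum continuous_on_base)
qed simp

lemma continuous_on_Phi: "continuous_on W (Phi n)"
proof (rule continuous_on_nat3I)
  show "continuous_on W (\<lambda>u. Phi n u 0)" "continuous_on W (\<lambda>u. Phi n u (Suc 0))"
    unfolding Phi_def act_def
    by (auto intro!: continuous_intros continuous_on_Psi continuous_on_coord)
  fix i
  show "continuous_on W (\<lambda>u. Phi n u (Suc (Suc i)))"
    unfolding Phi_def act_def by (simp add: continuous_on_base[where f="\<lambda>j. of_int ((j + n) mod int (p i))"])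
qed

sublocale Phi: int_action W Phi
  by standard (auto simp: compact_W Phi_in_W Phi_0 Phi_add continuous_on_Phi)

lemma pt_tendsto:
  assumes X: "\<And>i. \<forall>\<^sub>F k in sequentially. X k i mod int (p i) = y i mod int (p i)"
    and T: "\<And>k. \<exists>h::int. \<bar>T k - t - of_int h\<bar> \<le> e k" and e: "e \<longlonglongrightarrow> 0"
  shows "(\<lambda>k. pt (X k) (T k)) \<longlonglongrightarrow> pt y t"
proof -
  obtain h :: "nat \<Rightarrow> int" where h: "\<And>k. \<bar>T k - t - of_int (h k)\<bar> \<le> e k" using T by metis
  have "(\<lambda>k. T k - t - of_int (h k)) \<longlonglongrightarrow> 0"
    by (rule Lim_null_comparison[OF _ e]) (simp add: h)
  then have lim: "(\<lambda>k. T k + of_int (- h k)) \<longlonglongrightarrow> t"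
    by (subst LIM_zero_iff[symmetric]) (simp add: algebra_simps)
  show ?thesis
  proof (rule tendsto_fun_componentwise)
    fix c
    consider "c = 0" | "c = Suc 0" | i where "c = Suc (Suc i)" by (metis nat.exhaust)
    then show "(\<lambda>k. pt (X k) (T k) c) \<longlonglongrightarrow> pt y t c"
    proof cases
      case 1
      have "(\<lambda>k. cos (2 * pi * (T k + of_int (- h k)))) \<longlonglongrightarrow> cos (2 * pi * t)"
        by (intro tendsto_intros lim)
      then show ?thesis using 1 unfolding cos_sin_add_int by simp
    next
      case 2
      have "(\<lambda>k. sin (2 * pi * (T k + of_int (- h k)))) \<longlonglongrightarrow> sin (2 * pi * t)"
        by (intro tendsto_intros lim)
      then show ?thesis using 2 unfolding cos_sin_add_int by simp
    next
      case (3 i)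
      have "\<forall>\<^sub>F k in sequentially. pt (X k) (T k) c = pt y t c"
        using X[of i] by eventually_elim (simp add: 3)
      then show ?thesis by (rule tendsto_eventually)
    qed
  qed
qed

definition J :: "((nat \<Rightarrow> real) \<times> (nat \<Rightarrow> real)) set" where
  "J = {(pt x t, pt (\<lambda>i. x i + beta i) s) | x t s. True}"

lemma J_cases:
  assumes "z \<in> J"
  obtains x t s where "z = (pt x t, pt (\<lambda>i. x i + beta i) s)"
  using assms by (auto simp: J_def)

lemma J_subset: "J \<subseteq> W \<times> W"
  by (auto elim!: J_cases)

lemma pt_in_J [simp]: "(pt x t, pt (\<lambda>i. x i + beta i) s) \<in> J"
  by (auto simp: J_def)

lemma compact_J: "compact J"
proof -
  define g where "g = (\<lambda>(u, v). \<lambda>k. case k of 0 \<Rightarrow> v 0 | Suc 0 \<Rightarrow> v (Suc 0)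
     | Suc (Suc i) \<Rightarrow> real_of_int ((base u i + beta i) mod int (p i)))"
  have g: "g (pt x t, pt y s) = pt (\<lambda>i. x i + beta i) s" for x t y s
    by (intro fun_eq_nat3I) (auto simp: g_def mod_add_left_eq)
  have "continuous_on (W \<times> W) g"
  proof (rule continuous_on_nat3I)
    show "continuous_on (W \<times> W) (\<lambda>z. g z 0)" "continuous_on (W \<times> W) (\<lambda>z. g z (Suc 0))"
      by (auto simp: g_def case_prod_unfold
          intro!: continuous_on_compose2[OF continuous_on_coord[of UNIV] continuous_on_snd[OF continuous_on_id]])
    fix i
    have "continuous_on (W \<times> W) (\<lambda>z. real_of_int ((base (fst z) i + beta i) mod int (p i)))"
      by (rule continuous_on_compose2[OF continuous_on_base[where f="\<lambda>j. of_int ((j + beta i) mod int (p i))"]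
            continuous_on_fst[OF continuous_on_id]]) auto
    then show "continuous_on (W \<times> W) (\<lambda>z. g z (Suc (Suc i)))"
      by (simp add: g_def case_prod_unfold)
  qed
  then have "compact ((\<lambda>z. (fst z, g z)) ` (W \<times> W))"
    by (intro compact_continuous_image compact_Times compact_W continuous_on_Pair continuous_on_fst continuous_on_id)
  also have "(\<lambda>z. (fst z, g z)) ` (W \<times> W) = J"
  proof (intro equalityI subsetI)
    fix z assume "z \<in> (\<lambda>z. (fst z, g z)) ` (W \<times> W)"
    then show "z \<in> J" by (auto elim!: W_cases simp: g)
  next
    fix z assume "z \<in> J"
    then obtain x t s where z: "z = (pt x t, pt (\<lambda>i. x i + beta i) s)" by (rule J_cases)
    show "z \<in> (\<lambda>z. (fst z, g z)) ` (W \<times> W)"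
      unfolding z by (intro image_eqI[where x="(pt x t, pt x s)"]) (auto simp: g)
  qed
  finally show ?thesis .
qed

abbreviation Phi2 :: "int \<Rightarrow> (nat \<Rightarrow> real) \<times> (nat \<Rightarrow> real) \<Rightarrow> (nat \<Rightarrow> real) \<times> (nat \<Rightarrow> real)" where
  "Phi2 n \<equiv> map_prod (Phi n) (Phi n)"

lemma Phi2_J:
  "Phi2 n (pt x t, pt (\<lambda>i. x i + beta i) s) =
    (pt (\<lambda>i. x i + n) (t + of_int n * \<alpha> + Psi n x),
     pt (\<lambda>i. (x i + n) + beta i) (s + of_int n * \<alpha> + Psi n (\<lambda>i. x i + beta i)))"
  by (simp add: Phi_pt ac_simps)

lemma Phi2_in_J: "z \<in> J \<Longrightarrow> Phi2 n z \<in> J"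
  by (elim J_cases) (simp only: Phi2_J pt_in_J)

lemma continuous_on_Phi2: "continuous_on (W \<times> W) (Phi2 n)"
proof -
  have "continuous_on (W \<times> W) (\<lambda>z. (Phi n (fst z), Phi n (snd z)))"
    by (intro continuous_on_Pair continuous_on_compose2[OF continuous_on_Phi continuous_on_fst[OF continuous_on_id]]
        continuous_on_compose2[OF continuous_on_Phi continuous_on_snd[OF continuous_on_id]]) auto
  then show ?thesis by (simp add: map_prod_def case_prod_unfold)
qed

sublocale Phi_WW: int_action "W \<times> W" Phi2
  by standard (auto simp: compact_W compact_Times Phi_in_W Phi_0 Phi_add continuous_on_Phi2)

sublocale Phi_J: int_action J Phi2
proof
  show "continuous_on J (Phi2 n)" for n
    using continuous_on_Phi2 J_subset by (rule continuous_on_subset)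
qed (use J_subset in \<open>auto simp: compact_J Phi2_in_J Phi_0 Phi_add\<close>)

lemma J_orbit_dense:
  assumes "z \<in> J" "z' \<in> J"
  shows "\<exists>ns. (\<lambda>k. Phi2 (ns k) z) \<longlonglongrightarrow> z'"
proof -
  obtain x t s where z: "z = (pt x t, pt (\<lambda>i. x i + beta i) s)" using assms(1) by (rule J_cases)
  obtain y t' s' where z': "z' = (pt y t', pt (\<lambda>i. y i + beta i) s')" using assms(2) by (rule J_cases)
  let ?Q = "\<lambda>k n. (\<forall>i<k. (x i + int n) mod int (p i) = y i mod int (p i)) \<and>
     (\<exists>h::int. \<bar>t + real n * \<alpha> + Psi (int n) x - t' - of_int h\<bar> \<le> 3 * (1/2) ^ k) \<and>
     (\<exists>h::int. \<bar>s + real n * \<alpha> + Psi (int n) (\<lambda>i. x i + beta i) - s' - of_int h\<bar> \<le> 3 * (1/2) ^ k)"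
  have "\<forall>k. \<exists>n. ?Q k n" using steering by blast
  then obtain n where "\<forall>k. ?Q k (n k)" by (rule exE[OF choice])
  then have n: "\<And>k i. i < k \<Longrightarrow> (x i + int (n k)) mod int (p i) = y i mod int (p i)"
     "\<And>k. \<exists>h::int. \<bar>t + n k * \<alpha> + Psi (int (n k)) x - t' - of_int h\<bar> \<le> 3 * (1/2) ^ k"
     "\<And>k. \<exists>h::int. \<bar>s + n k * \<alpha> + Psi (int (n k)) (\<lambda>i. x i + beta i) - s' - of_int h\<bar> \<le> 3 * (1/2) ^ k"
    by blast+
  have e: "(\<lambda>k. 3 * (1/2::real) ^ k) \<longlonglongrightarrow> 0"
    using tendsto_mult_right_zero[OF LIMSEQ_power_zero[of "1/2::real"], of 3] by simp
  have ev: "\<forall>\<^sub>F k in sequentially. (x i + int (n k)) mod int (p i) = y i mod int (p i)" for i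
    using eventually_gt_at_top[of i] by eventually_elim (rule n(1))
  have ev': "\<forall>\<^sub>F k in sequentially. (x i + int (n k) + beta i) mod int (p i) = (y i + beta i) mod int (p i)" for i
    using ev[of i] by eventually_elim (rule mod_add_cong, auto)
  have "(\<lambda>k. Phi2 (int (n k)) z) \<longlonglongrightarrow> z'"
    unfolding z z' Phi2_J
    by (intro tendsto_Pair pt_tendsto[OF ev _ e] pt_tendsto[OF ev' _ e]) (use n(2,3) in simp_all)
  then show ?thesis by (intro exI[of _ "\<lambda>k. int (n k)"])
qed

lemma minimal_J: "minimal_flow (top_of_set J) (Phi2 1)"
  by (rule Phi_J.minimal_flowI) (rule J_orbit_dense)

lemma W_orbit_dense:
  assumes "u \<in> W" "v \<in> W"
  shows "\<exists>ns. (\<lambda>k. Phi (ns k) u) \<longlonglongrightarrow> v"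
proof -
  obtain x t y s where u: "u = pt x t" "v = pt y s" using assms by (metis W_cases)
  obtain ns where "(\<lambda>k. Phi2 (ns k) (pt x t, pt (\<lambda>i. x i + beta i) 0)) \<longlonglongrightarrow> (pt y s, pt (\<lambda>i. y i + beta i) 0)"
    using J_orbit_dense[OF pt_in_J pt_in_J] by blast
  from tendsto_fst[OF this] show ?thesis unfolding u by auto
qed

lemma minimal_W: "minimal_flow (top_of_set W) (Phi 1)"
  by (rule Phi.minimal_flowI) (rule W_orbit_dense)

lemma join_space_eq:
  "join_space (top_of_set W) (pt (\<lambda>_. 0) 0) (Phi 1) (top_of_set W) (pt beta 0) (Phi 1) = top_of_set J"
proof -
  let ?a = "(pt (\<lambda>_. 0) 0, pt beta 0)"
  have a: "?a \<in> J" using pt_in_J[of "\<lambda>_. 0" 0 0] by simp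
  have "top_of_set (W \<times> W) closure_of flow_orbit (top_of_set (W \<times> W)) (Phi2 1) ?a = J"
    by (rule Phi_WW.orbit_closure_eq)
      (auto simp: compact_imp_closed[OF compact_J] J_subset a Phi2_in_J[OF a] simp del: map_prod_simp
        intro: J_orbit_dense[OF a])
  then show ?thesis
    using J_subset by (simp add: join_space_def subtopology_subtopology Int_absorb1)
qed

text \<open>
  The flow is an isometric extension of an isometry. Distinct base points differ in some residue, and
  this persists; over the same base point the two fibres are rotated by the same angle.
\<close>

lemma distal_W: "distal_flow (top_of_set W) (Phi 1)"
proof (rule Phi.distal_flowI[where g="\<lambda>i u. if i = 0 then (u 0, u (Suc 0)) else (u (Suc i), 0)"])
  fix i show "continuous_on W (\<lambda>u. if i = 0 then (u 0, u (Suc 0)) else (u (Suc i), 0))"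
    by (cases "i = 0") (auto intro!: continuous_intros continuous_on_coord)
next
  fix u v assume uv: "u \<in> W" "v \<in> W" "u \<noteq> v"
  then obtain x t y s where u: "u = pt x t" "v = pt y s" by (metis W_cases)
  let ?g = "\<lambda>i u. if i = 0 then (u 0, u (Suc 0)) else (u (Suc i), 0 :: real)"
  show "\<exists>i::nat. \<exists>c>0. \<forall>n. c \<le> dist (?g i (Phi n u)) (?g i (Phi n v))"
  proof (cases "\<forall>i. x i mod int (p i) = y i mod int (p i)")
    case False
    then obtain i where i: "x i mod int (p i) \<noteq> y i mod int (p i)" by blast
    have "1 \<le> dist (?g (Suc i) (Phi n u)) (?g (Suc i) (Phi n v))" for n
    proof -
      have "(x i + n) mod int (p i) \<noteq> (y i + n) mod int (p i)"
        using i by (metis cong_add_rcancel cong_def)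
      then have "\<bar>(x i + n) mod int (p i) - (y i + n) mod int (p i)\<bar> \<ge> 1" by linarith
      then have "\<bar>real_of_int ((x i + n) mod int (p i)) - real_of_int ((y i + n) mod int (p i))\<bar> \<ge> 1"
        by linarith
      then show ?thesis by (simp add: u Phi_pt dist_Pair_Pair dist_real_def)
    qed
    then show ?thesis by (intro exI[of _ "Suc i"] exI[of _ 1]) simp
  next
    case True
    have dist_pt: "dist (?g 0 (pt x' a)) (?g 0 (pt y' b)) = sqrt (2 - 2 * cos (2 * pi * (a - b)))" for x' y' a b
    proof -
      have "(cos \<theta> - cos \<phi>)\<^sup>2 + (sin \<theta> - sin \<phi>)\<^sup>2 = 2 - 2 * cos (\<theta> - \<phi>)" for \<theta> \<phi> :: real
        using sin_cos_squared_add3[of \<theta>] sin_cos_squared_add3[of \<phi>]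
        by (simp add: cos_diff power2_eq_square algebra_simps)
      then show ?thesis
        by (simp add: dist_Pair_Pair dist_real_def right_diff_distrib)
    qed
    have Psi: "Psi n x = Psi n y" for n by (rule Psi_cong) (use True in simp)
    have "?g 0 u \<noteq> ?g 0 v"
      using uv(3) True unfolding u by (auto intro: fun_eq_nat3I)
    then have "0 < dist (?g 0 u) (?g 0 v)" by simp
    moreover have "dist (?g 0 (Phi n u)) (?g 0 (Phi n v)) = dist (?g 0 u) (?g 0 v)" for n
      unfolding u Phi_pt dist_pt Psi by simp
    ultimately show ?thesis by (intro exI[of _ 0] exI[of _ "dist (?g 0 u) (?g 0 v)"]) simp
  qed
qed

section \<open>Haar measure on the base\<close>

definition haar :: "(nat \<Rightarrow> int) measure" where
  "haar = PiM UNIV (\<lambda>i. cyclic_measure (p i))"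

lemma product_prob_space_cyclic: "product_prob_space (\<lambda>i. cyclic_measure (p i))"
  by (intro product_prob_spaceI) (rule measure_pmf.prob_space_axioms)

interpretation haar: product_prob_space "\<lambda>i. cyclic_measure (p i)" UNIV
  by (rule product_prob_space_cyclic)

lemma prob_space_haar: "prob_space haar"
  unfolding haar_def by (rule haar.P.prob_space_axioms)

lemma space_haar [simp]: "space haar = UNIV"
  by (simp add: haar_def space_PiM)

lemma measurable_haar_component: "(\<lambda>x. x i) \<in> measurable haar (count_space UNIV)"
  using measurable_component_singleton[of i UNIV "\<lambda>i. cyclic_measure (p i)"]
  by (simp add: haar_def measurable_pmf_measure2)

lemma measurable_haar_fun: "(\<lambda>x. f (x i)) \<in> measurable haar L" if "range f \<subseteq> space L"
  using measurable_compose[OF measurable_haar_component, of f L] that by auto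

lemma measurable_into_haar:
  assumes "\<And>i. (\<lambda>\<omega>. X \<omega> i) \<in> measurable M (count_space UNIV)"
  shows "X \<in> measurable M haar"
  unfolding haar_def
  by (rule measurable_abs_UNIV) (use assms in \<open>simp add: measurable_pmf_measure2\<close>)

definition rot :: "(nat \<Rightarrow> int) \<Rightarrow> (nat \<Rightarrow> int) \<Rightarrow> nat \<Rightarrow> int" where
  "rot b x i = (b i + x i) mod int (p i)"

lemma measurable_rot: "rot b \<in> measurable haar haar"
  by (rule measurable_into_haar)
    (unfold rot_def, rule measurable_haar_fun[where f="\<lambda>j. (b i + j) mod int (p i)" for i], simp)

definition cyl :: "nat set \<Rightarrow> (nat \<Rightarrow> int set) \<Rightarrow> (nat \<Rightarrow> int) set" where
  "cyl I E = {x. \<forall>i\<in>I. x i \<in> E i}"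

lemma cyl_eq: "prod_emb UNIV (\<lambda>i. cyclic_measure (p i)) I (PiE I E) = cyl I E"
  by (auto simp: prod_emb_def cyl_def restrict_def PiE_iff extensional_def space_PiM)

lemma sets_cyl: "finite I \<Longrightarrow> cyl I E \<in> sets haar"
  unfolding haar_def cyl_eq[symmetric] by (rule sets_PiM_I) auto

lemma haar_cyl: "finite I \<Longrightarrow> emeasure haar (cyl I E) = (\<Prod>i\<in>I. emeasure (cyclic_measure (p i)) (E i))"
  unfolding haar_def cyl_eq[symmetric] by (rule haar.emeasure_PiM_emb) auto

lemma haar_eqI:
  assumes "sets M = sets haar"
    and "\<And>I E. finite I \<Longrightarrow> emeasure M (cyl I E) = emeasure haar (cyl I E)"
  shows "M = haar"
  unfolding haar_def
proof (rule haar.PiM_eq)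
  show "sets M = sets (PiM UNIV (\<lambda>i. cyclic_measure (p i)))" using assms(1) by (simp add: haar_def)
  fix I :: "nat set" and E assume "finite I"
  then show "emeasure M (prod_emb UNIV (\<lambda>i. cyclic_measure (p i)) I (PiE I E)) =
      (\<Prod>i\<in>I. emeasure (cyclic_measure (p i)) (E i))"
    unfolding cyl_eq using assms(2) by (simp add: haar_cyl)
qed

lemma distr_rot: "distr haar haar (rot b) = haar"
proof (rule haar_eqI)
  fix I :: "nat set" and E assume I: "finite I"
  have "emeasure (distr haar haar (rot b)) (cyl I E) = emeasure haar (cyl I (\<lambda>i. {j. (b i + j) mod int (p i) \<in> E i}))"
  proof -
    have "rot b -` cyl I E \<inter> space haar = cyl I (\<lambda>i. {j. (b i + j) mod int (p i) \<in> E i})"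
      by (auto simp: cyl_def rot_def)
    then show ?thesis by (simp only: emeasure_distr[OF measurable_rot sets_cyl[OF I]])
  qed
  also have "\<dots> = (\<Prod>i\<in>I. emeasure (cyclic_measure (p i)) {j. (b i + j) mod int (p i) \<in> E i})"
    using I by (rule haar_cyl)
  also have "\<dots> = (\<Prod>i\<in>I. emeasure (cyclic_measure (p i)) (E i))"
  proof (rule prod.cong[OF refl])
    fix i
    have "emeasure (cyclic_measure (p i)) (E i)
      = emeasure (measure_pmf (map_pmf (\<lambda>j. (b i + j) mod int (p i)) (pmf_of_set {0..<int (p i)}))) (E i)"
      by (simp add: map_pmf_cyclic)
    also have "\<dots> = emeasure (cyclic_measure (p i)) {j. (b i + j) mod int (p i) \<in> E i}"
      by (simp add: vimage_def)
    finally show "emeasure (cyclic_measure (p i)) {j. (b i + j) mod int (p i) \<in> E i} = emeasure (cyclic_measure (p i)) (E i)"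
      by simp
  qed
  finally show "emeasure (distr haar haar (rot b)) (cyl I E) = emeasure haar (cyl I E)"
    using I by (simp add: haar_cyl)
qed simp

text \<open>
  On a set depending on finitely many coordinates, translation by any \<open>b\<close> agrees with translation by a
  suitable constant natural number, by the Chinese remainder theorem. So the measure of such a set is
  unchanged under all translations, and averaging over \<open>b\<close> with respect to Haar measure gives the claim.
\<close>

lemma haar_unique:
  assumes sets: "sets \<nu> = sets haar" and prob: "prob_space \<nu>"
    and inv: "\<And>n::nat. distr \<nu> haar (rot (\<lambda>_. int n)) = \<nu>"
  shows "\<nu> = haar"
proof (rule haar_eqI[OF sets])
  interpret L: prob_space \<nu> by (rule prob)
  interpret H: prob_space haar by (rule prob_space_haar)
  interpret pair_sigma_finite \<nu> haar by unfold_locales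
  note [measurable_cong] = sets
  have rot_L: "rot b \<in> measurable \<nu> haar" for b
    using measurable_rot by (simp cong: measurable_cong_sets add: sets)
  have space_L: "space \<nu> = UNIV" using sets_eq_imp_space_eq[OF sets] by simp
  fix I :: "nat set" and E assume I: "finite I"
  have translate: "emeasure \<nu> (rot b -` cyl I E) = emeasure \<nu> (cyl I E)" for b
  proof -
    obtain k where k: "I \<subseteq> {..<k}" using I finite_nat_bounded by blast
    obtain n :: nat where n: "\<And>i. i < k \<Longrightarrow> int n mod int (p i) = b i mod int (p i)"
      using chinese_remainder by blast
    have "rot b x i = rot (\<lambda>_. int n) x i" if "i \<in> I" for x i
      unfolding rot_def using k that by (intro mod_add_cong n[symmetric]) auto
    then have "rot b -` cyl I E = rot (\<lambda>_. int n) -` cyl I E" by (auto simp: cyl_def)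
    also have "emeasure \<nu> \<dots> = emeasure (distr \<nu> haar (rot (\<lambda>_. int n))) (cyl I E)"
      using I by (simp add: emeasure_distr rot_L sets_cyl space_L)
    finally show ?thesis by (simp add: inv)
  qed
  have comm: "rot b x = rot x b" for b x by (simp add: rot_def fun_eq_iff add.commute)
  have meas: "(\<lambda>z. rot (snd z) (fst z)) \<in> measurable (\<nu> \<Otimes>\<^sub>M haar) haar"
  proof (rule measurable_into_haar)
    fix i
    have "(\<lambda>z. snd z i) \<in> measurable (\<nu> \<Otimes>\<^sub>M haar) (count_space UNIV)"
      by (rule measurable_compose[OF measurable_snd measurable_haar_component])
    moreover have "(\<lambda>x. x i) \<in> measurable \<nu> (count_space UNIV)"
      using measurable_haar_component by (simp cong: measurable_cong_sets add: sets)
    then have "(\<lambda>z. fst z i) \<in> measurable (\<nu> \<Otimes>\<^sub>M haar) (count_space UNIV)"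
      by (rule measurable_compose[OF measurable_fst])
    ultimately show "(\<lambda>z. rot (snd z) (fst z) i) \<in> measurable (\<nu> \<Otimes>\<^sub>M haar) (count_space UNIV)"
      unfolding rot_def by measurable
  qed
  have ind: "(\<lambda>z. indicator (cyl I E) (rot (snd z) (fst z)) :: ennreal) \<in> borel_measurable (\<nu> \<Otimes>\<^sub>M haar)"
    by (rule measurable_compose[OF meas borel_measurable_indicator[OF sets_cyl[OF I]]])
  have "emeasure \<nu> (cyl I E) = (\<integral>\<^sup>+b. emeasure \<nu> (rot b -` cyl I E) \<partial>haar)"
    by (simp add: translate H.emeasure_space_1[unfolded space_haar])
  also have "\<dots> = (\<integral>\<^sup>+b. (\<integral>\<^sup>+x. indicator (cyl I E) (rot b x) \<partial>\<nu>) \<partial>haar)"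
  proof (rule nn_integral_cong)
    fix b
    have "rot b -` cyl I E \<in> sets \<nu>"
      using measurable_sets[OF rot_L sets_cyl[OF I]] by (simp add: space_L)
    then have "emeasure \<nu> (rot b -` cyl I E) = (\<integral>\<^sup>+x. indicator (rot b -` cyl I E) x \<partial>\<nu>)" by simp
    then show "emeasure \<nu> (rot b -` cyl I E) = (\<integral>\<^sup>+x. indicator (cyl I E) (rot b x) \<partial>\<nu>)"
      by (simp add: indicator_def)
  qed
  also have "\<dots> = (\<integral>\<^sup>+x. (\<integral>\<^sup>+b. indicator (cyl I E) (rot b x) \<partial>haar) \<partial>\<nu>)"
    by (rule Fubini') (use ind in \<open>simp add: case_prod_unfold\<close>)
  also have "\<dots> = (\<integral>\<^sup>+x. emeasure haar (cyl I E) \<partial>\<nu>)"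
  proof (rule nn_integral_cong)
    fix x
    have "(\<integral>\<^sup>+b. indicator (cyl I E) (rot b x) \<partial>haar) = (\<integral>\<^sup>+b. indicator (cyl I E) b \<partial>distr haar haar (rot x))"
      by (subst nn_integral_distr) (auto simp: measurable_rot comm intro!: borel_measurable_indicator sets_cyl I)
    then show "(\<integral>\<^sup>+b. indicator (cyl I E) (rot b x) \<partial>haar) = emeasure haar (cyl I E)"
      by (simp add: distr_rot sets_cyl I)
  qed
  also have "\<dots> = emeasure haar (cyl I E)" by (simp add: L.emeasure_space_1)
  finally show "emeasure \<nu> (cyl I E) = emeasure haar (cyl I E)" .
qed

lemma measurable_pt:
  assumes X: "X \<in> measurable M haar" and T: "T \<in> borel_measurable M"
  shows "(\<lambda>\<omega>. pt (X \<omega>) (T \<omega>)) \<in> borel_measurable M"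
proof (rule measurable_coordinatewise_then_product)
  fix c
  consider "c = 0" | "c = Suc 0" | i where "c = Suc (Suc i)" by (metis nat.exhaust)
  then show "(\<lambda>\<omega>. pt (X \<omega>) (T \<omega>) c) \<in> borel_measurable M"
  proof cases
    case (3 i)
    have "(\<lambda>x. real_of_int (x i mod int (p i))) \<in> borel_measurable haar"
      by (rule measurable_haar_fun) simp
    then show ?thesis using measurable_compose[OF X] 3 by simp
  qed (use T in simp_all)
qed

lemma measurable_base: "base \<in> measurable borel haar"
proof (rule measurable_into_haar)
  fix i
  have "(\<lambda>u :: nat \<Rightarrow> real. u (Suc (Suc i))) \<in> borel_measurable borel"
    by (rule borel_measurable_continuous_onI) (rule continuous_on_coord)
  then show "(\<lambda>u. base u i) \<in> measurable borel (count_space UNIV)"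
    unfolding base_def by measurable
qed

section \<open>Unique ergodicity\<close>

lemma act_0_pt: "act 0 t (pt x s) = pt x (s + t)"
  by (simp add: act_pt)

text \<open>
  Each rotation of the fibres is a pointwise limit of powers of the flow. Hence every invariant measure
  is also invariant under these rotations.
\<close>

lemma Phi_rigid:
  assumes "u \<in> W"
  shows "\<exists>n. \<forall>v\<in>W. (\<lambda>k. Phi (int (n k)) v) \<longlonglongrightarrow> act 0 t v"
proof -
  obtain n where n: "\<And>k. n k \<le> N k" "\<And>k i. i < k \<Longrightarrow> p i dvd n k"
    "\<And>k. \<exists>h::int. \<bar>n k * \<alpha> - t - of_int h\<bar> \<le> (1/2) ^ k"
    using rigid_times[of _ t] by metis
  have "(\<lambda>k. Phi (int (n k)) v) \<longlonglongrightarrow> act 0 t v" if "v \<in> W" for v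
  proof -
    obtain x s where v: "v = pt x s" using \<open>v \<in> W\<close> by (rule W_cases)
    show ?thesis unfolding v Phi_pt act_0_pt
    proof (rule pt_tendsto)
      fix i
      have *: "(x i + int (n k)) mod int (p i) = x i mod int (p i)" if "i < k" for k
        using n(2)[OF that] by (metis add.right_neutral dvd_imp_mod_0 mod_add_right_eq of_nat_dvd_iff)
      show "\<forall>\<^sub>F k in sequentially. (x i + int (n k)) mod int (p i) = x i mod int (p i)"
        by (rule eventually_mono[OF eventually_gt_at_top[of i]]) (rule *)
    next
      fix k
      obtain h :: int where "\<bar>n k * \<alpha> - t - of_int h\<bar> \<le> (1/2) ^ k" using n(3) by blast
      moreover have "\<bar>Psi (int (n k)) x\<bar> \<le> 2 * (1/2) ^ k" by (rule Psi_rigid) (use n in auto)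
      ultimately have "\<bar>s + of_int (int (n k)) * \<alpha> + Psi (int (n k)) x - (s + t) - of_int h\<bar> \<le> 3 * (1/2) ^ k"
        by simp
      then show "\<exists>h::int. \<bar>s + of_int (int (n k)) * \<alpha> + Psi (int (n k)) x - (s + t) - of_int h\<bar> \<le> 3 * (1/2) ^ k"
        by blast
    next
      show "(\<lambda>k. 3 * (1/2::real) ^ k) \<longlonglongrightarrow> 0"
        using tendsto_mult_right_zero[OF LIMSEQ_power_zero[of "1/2::real"], of 3] by simp
    qed
  qed
  then show ?thesis by blast
qed

text \<open>
  An invariant measure is invariant under the rotations of the fibres and has marginal \<open>haar\<close>.
  Averaging over the fibres by Fubini leaves a function of the base point, whose integral is determined.
\<close>

lemma invariant_formula:
  assumes inv: "invariant_borel_prob (top_of_set W) (Phi 1) \<mu>" and B: "B \<in> sets borel"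
  shows "emeasure \<mu> (B \<inter> W) = (\<integral>\<^sup>+x. (\<integral>\<^sup>+t. indicator B (pt x t) \<partial>circle_measure) \<partial>haar)"
proof -
  have space: "space \<mu> = W" and sets: "sets \<mu> = sets (restrict_space borel W)"
    and one: "emeasure \<mu> W = 1"
    and inv1: "\<And>A. A \<in> sets \<mu> \<Longrightarrow> emeasure \<mu> (Phi 1 -` A \<inter> W) = emeasure \<mu> A"
    using inv by (auto simp: invariant_borel_prob_def sets_borel_of_top_of_set)
  interpret prob_space \<mu> by (rule prob_spaceI) (simp add: space one)
  interpret C: prob_space circle_measure by (rule prob_space_circle_measure)
  interpret pair_sigma_finite circle_measure \<mu> by unfold_locales
  have meas_Phi: "Phi n \<in> measurable \<mu> \<mu>" for n
    using Phi.measurable_F[of n] by (simp cong: measurable_cong_sets add: sets)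
  have meas_borel: "f \<in> measurable \<mu> M" if "f \<in> measurable borel M" for f and M :: "'c measure"
    using measurable_restrict_space1[OF that, of W] by (simp cong: measurable_cong_sets add: sets)
  have id_borel: "(\<lambda>u. u) \<in> borel_measurable \<mu>" by (rule meas_borel) simp
  have distr1: "distr \<mu> \<mu> (Phi 1) = \<mu>"
    by (rule measure_eqI) (auto simp: emeasure_distr meas_Phi inv1 space)
  have distr_Phi: "distr \<mu> \<mu> (Phi (int n)) = \<mu>" for n
  proof (induction n)
    case 0
    have "distr \<mu> \<mu> (Phi 0) = distr \<mu> \<mu> (\<lambda>u. u)" by (rule distr_cong) (auto simp: space Phi_0)
    then show ?case by (simp add: distr_id)
  next
    case (Suc n)
    have "distr \<mu> \<mu> (Phi (int (Suc n))) = distr \<mu> \<mu> (Phi 1 \<circ> Phi (int n))"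
      by (rule distr_cong) (auto simp: space Phi_add)
    also have "\<dots> = distr (distr \<mu> \<mu> (Phi (int n))) \<mu> (Phi 1)"
      by (rule distr_distr[symmetric]) (auto simp: meas_Phi)
    finally show ?case by (simp add: Suc distr1)
  qed
  have base_meas: "base \<in> measurable \<mu> haar" by (rule meas_borel) (rule measurable_base)
  have marginal: "distr \<mu> haar base = haar"
  proof (rule haar_unique)
    show "prob_space (distr \<mu> haar base)" using base_meas by (rule prob_space_distr)
    fix n :: nat
    have "distr (distr \<mu> haar base) haar (rot (\<lambda>_. int n)) = distr \<mu> haar (rot (\<lambda>_. int n) \<circ> base)"
      by (intro distr_distr measurable_rot base_meas)
    also have "\<dots> = distr \<mu> haar (base \<circ> Phi (int n))"
      by (rule distr_cong) (auto simp: space rot_def fun_eq_iff Phi_pt mod_add_right_eq add.commute elim!: W_cases)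
    also have "\<dots> = distr (distr \<mu> \<mu> (Phi (int n))) haar base"
      by (intro distr_distr[symmetric] meas_Phi base_meas)
    finally show "distr (distr \<mu> haar base) haar (rot (\<lambda>_. int n)) = distr \<mu> haar base"
      by (simp add: distr_Phi)
  qed simp
  have act_meas: "(\<lambda>z. act 0 (fst z) (snd z)) \<in> borel_measurable (circle_measure \<Otimes>\<^sub>M \<mu>)"
  proof -
    have c: "(\<lambda>z. snd z k) \<in> borel_measurable (circle_measure \<Otimes>\<^sub>M \<mu>)" for k
      by (rule measurable_compose[OF measurable_snd])
        (intro meas_borel borel_measurable_continuous_onI continuous_on_coord)
    have cs: "(\<lambda>z. cos (2 * pi * fst z)) \<in> borel_measurable (circle_measure \<Otimes>\<^sub>M \<mu>)"
      "(\<lambda>z. sin (2 * pi * fst z)) \<in> borel_measurable (circle_measure \<Otimes>\<^sub>M \<mu>)"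
      by measurable
    have b: "(\<lambda>z. base (snd z) i) \<in> measurable (circle_measure \<Otimes>\<^sub>M \<mu>) (count_space UNIV)" for i
      using measurable_compose[OF measurable_compose[OF measurable_snd base_meas] measurable_haar_component] .
    show ?thesis
    proof (rule measurable_coordinatewise_then_product)
      fix k
      consider "k = 0" | "k = Suc 0" | i where "k = Suc (Suc i)" by (metis nat.exhaust)
      then show "(\<lambda>z. act 0 (fst z) (snd z) k) \<in> borel_measurable (circle_measure \<Otimes>\<^sub>M \<mu>)"
      proof cases
        case (3 i)
        have "(\<lambda>z. real_of_int (base (snd z) i mod int (p i))) \<in> borel_measurable (circle_measure \<Otimes>\<^sub>M \<mu>)"
          by (rule measurable_compose[OF b]) simp
        then show ?thesis by (simp add: act_def 3)
      qed (auto simp: act_def intro!: borel_measurable_diff borel_measurable_add borel_measurable_times c cs)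
    qed
  qed
  have act_meas1: "act 0 t \<in> borel_measurable \<mu>" for t
    using measurable_compose[OF measurable_Pair1' act_meas, of t] by simp
  have fibre: "distr \<mu> borel (\<lambda>u. u) = distr \<mu> borel (act 0 t)" for t
  proof (rule borel_measure_eqI_continuous)
    show "finite_measure (distr \<mu> borel (\<lambda>u. u))" "finite_measure (distr \<mu> borel (act 0 t))"
      by (intro finite_measure_distr id_borel act_meas1)+
    fix f :: "(nat \<Rightarrow> real) \<Rightarrow> real" assume f: "continuous_on UNIV f" "\<And>u. \<bar>f u\<bar> \<le> 1"
    have f_borel: "f \<in> borel_measurable borel" using f(1) by (rule borel_measurable_continuous_onI)
    obtain n where n: "\<And>v. v \<in> W \<Longrightarrow> (\<lambda>k. Phi (int (n k)) v) \<longlonglongrightarrow> act 0 t v"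
      using Phi_rigid[OF pt_in_W, of t] by blast
    have "(\<lambda>k. \<integral>u. f (Phi (int (n k)) u) \<partial>\<mu>) \<longlonglongrightarrow> (\<integral>u. f (act 0 t u) \<partial>\<mu>)"
    proof (rule integral_dominated_convergence[where w="\<lambda>_. 1"])
      show "(\<lambda>u. f (act 0 t u)) \<in> borel_measurable \<mu>"
        by (rule measurable_compose[OF act_meas1 f_borel])
      show "(\<lambda>u. f (Phi (int (n k)) u)) \<in> borel_measurable \<mu>" for k
        by (rule measurable_compose[OF meas_Phi meas_borel[OF f_borel]])
      show "AE u in \<mu>. (\<lambda>k. f (Phi (int (n k)) u)) \<longlonglongrightarrow> f (act 0 t u)"
      proof (rule AE_I2)
        fix u assume "u \<in> space \<mu>"
        then show "(\<lambda>k. f (Phi (int (n k)) u)) \<longlonglongrightarrow> f (act 0 t u)"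
          using n f(1) by (auto simp: space intro!: continuous_on_tendsto_compose[of UNIV f])
      qed
    qed (use f(2) in simp_all)
    moreover have "(\<integral>u. f (Phi (int (n k)) u) \<partial>\<mu>) = (\<integral>u. f u \<partial>\<mu>)" for k
      using integral_distr[OF meas_Phi[of "int (n k)"] meas_borel[OF f_borel]] by (simp add: distr_Phi)
    ultimately have "(\<integral>u. f u \<partial>\<mu>) = (\<integral>u. f (act 0 t u) \<partial>\<mu>)"
      by (simp add: LIMSEQ_const_iff)
    then show "(\<integral>u. f u \<partial>distr \<mu> borel (\<lambda>u. u)) = (\<integral>u. f u \<partial>distr \<mu> borel (act 0 t))"
      by (simp add: integral_distr id_borel act_meas1 f_borel)
  qed simp_all
  define g where "g x = (\<integral>\<^sup>+t. indicator B (pt x t) \<partial>circle_measure)" for x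
  have g_meas: "g \<in> borel_measurable haar"
  proof -
    have "(\<lambda>z. pt (fst z) (snd z)) \<in> borel_measurable (haar \<Otimes>\<^sub>M circle_measure)"
      by (rule measurable_pt) measurable
    then have "(\<lambda>z. indicator B (pt (fst z) (snd z)) :: ennreal) \<in> borel_measurable (haar \<Otimes>\<^sub>M circle_measure)"
      by (rule measurable_compose) (rule borel_measurable_indicator[OF B])
    from C.borel_measurable_nn_integral_fst[OF this] show ?thesis by (simp add: g_def[abs_def])
  qed
  have B_act: "emeasure \<mu> (B \<inter> W) = (\<integral>\<^sup>+u. indicator B (act 0 t u) \<partial>\<mu>)" for t
  proof -
    have "emeasure \<mu> (B \<inter> W) = emeasure (distr \<mu> borel (\<lambda>u. u)) B"
      using B by (simp add: emeasure_distr id_borel space)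
    also have "\<dots> = (\<integral>\<^sup>+u. indicator B u \<partial>distr \<mu> borel (act 0 t))"
      using B by (simp add: fibre[of t])
    also have "\<dots> = (\<integral>\<^sup>+u. indicator B (act 0 t u) \<partial>\<mu>)"
      by (intro nn_integral_distr act_meas1 borel_measurable_indicator) (simp add: B)
    finally show ?thesis .
  qed
  have "emeasure \<mu> (B \<inter> W) = (\<integral>\<^sup>+t. (\<integral>\<^sup>+u. indicator B (act 0 t u) \<partial>\<mu>) \<partial>circle_measure)"
    by (simp add: B_act[symmetric] C.emeasure_space_1[unfolded space_circle_measure])
  also have "\<dots> = (\<integral>\<^sup>+u. (\<integral>\<^sup>+t. indicator B (act 0 t u) \<partial>circle_measure) \<partial>\<mu>)"
  proof (rule Fubini'[symmetric])
    have "(\<lambda>z. indicator B (act 0 (fst z) (snd z)) :: ennreal) \<in> borel_measurable (circle_measure \<Otimes>\<^sub>M \<mu>)"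
      by (rule measurable_compose[OF act_meas borel_measurable_indicator[OF B]])
    then show "(\<lambda>(t, u). indicator B (act 0 t u) :: ennreal) \<in> borel_measurable (circle_measure \<Otimes>\<^sub>M \<mu>)"
      by (simp add: case_prod_unfold)
  qed
  also have "\<dots> = (\<integral>\<^sup>+u. g (base u) \<partial>\<mu>)"
  proof (rule nn_integral_cong)
    fix u assume "u \<in> space \<mu>"
    then obtain x s where u: "u = pt x s" unfolding space by (rule W_cases)
    have pt_meas: "pt x \<in> borel_measurable borel"
      by (rule measurable_pt) simp_all
    have "(\<integral>\<^sup>+t. indicator B (pt x (t + s)) \<partial>circle_measure) = (\<integral>\<^sup>+t. indicator B (pt x t) \<partial>circle_measure)"
      by (rule nn_integral_circle_shift)
        (auto simp: pt_add_int intro!: measurable_compose[OF pt_meas] borel_measurable_indicator B)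
    then show "(\<integral>\<^sup>+t. indicator B (act 0 t u) \<partial>circle_measure) = g (base u)"
      by (simp add: u act_0_pt g_def add.commute)
  qed
  also have "\<dots> = (\<integral>\<^sup>+x. g x \<partial>distr \<mu> haar base)"
    by (rule nn_integral_distr[symmetric]) (simp_all add: base_meas g_meas)
  finally show ?thesis by (simp add: marginal g_def)
qed

lemma invariant_unique:
  assumes "invariant_borel_prob (top_of_set W) (Phi 1) \<mu>" "invariant_borel_prob (top_of_set W) (Phi 1) \<nu>"
  shows "\<mu> = \<nu>"
proof (rule measure_eqI)
  show "sets \<mu> = sets \<nu>" using assms by (simp add: invariant_borel_prob_def)
  fix A assume "A \<in> sets \<mu>"
  then have "A \<in> sets (restrict_space borel W)"
    using assms by (simp add: invariant_borel_prob_def sets_borel_of_top_of_set)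
  then obtain B where "B \<in> sets borel" "A = B \<inter> W"
    by (auto simp: sets_restrict_space)
  then show "emeasure \<mu> A = emeasure \<nu> A"
    using invariant_formula[OF assms(1)] invariant_formula[OF assms(2)] by simp
qed

section \<open>Two invariant measures on the self-joining\<close>

text \<open>
  The transfer function \<open>g (x + beta) - g x\<close> of the difference of the two fibre coordinates, from
  which the constant \<open>\<alpha>\<close> has disappeared. It is meaningful on the set of full measure where the series
  converges.
\<close>

definition D :: "(nat \<Rightarrow> int) \<Rightarrow> real" where
  "D x = (\<Sum>i. G i (x i + beta i) - G i (x i))"

lemma D_cong: "(\<And>i. x i mod int (p i) = y i mod int (p i)) \<Longrightarrow> D x = D y"
proof -
  assume *: "\<And>i. x i mod int (p i) = y i mod int (p i)"
  have "G i (x i + beta i) = G i (y i + beta i)" "G i (x i) = G i (y i)" for i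
    using *[of i] by (auto intro!: G_cong mod_add_cong)
  then show ?thesis by (simp add: D_def)
qed

lemma D_mod [simp]: "D (\<lambda>i. x i mod int (p i)) = D x"
  by (rule D_cong) simp

lemma measurable_D: "D \<in> borel_measurable haar"
  unfolding D_def[abs_def]
  by (intro borel_measurable_suminf measurable_haar_fun[where f="\<lambda>j. G i (j + beta i) - G i j" for i]) simp

text \<open>
  By the Borel-Cantelli lemma almost every \<open>x\<close> meets the supports of only finitely many tents.
\<close>

lemma AE_summable_G: "AE x in haar. summable (\<lambda>i. G i (x i))"
proof -
  interpret H: prob_space haar by (rule prob_space_haar)
  define A where "A i = cyl {i} (\<lambda>_. {j. G i j \<noteq> 0})" for i
  have A: "A i \<in> sets haar" for i unfolding A_def by (rule sets_cyl) simp
  have le: "measure haar (A i) \<le> (1/2) ^ i" for i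
  proof -
    have "emeasure haar (A i) = emeasure (cyclic_measure (p i)) {j. G i j \<noteq> 0}"
      by (simp add: A_def haar_cyl)
    then have "measure haar (A i) = measure (cyclic_measure (p i)) {j. G i j \<noteq> 0}"
      by (simp add: measure_def)
    also have "\<dots> = card ({0..<int (p i)} \<inter> {j. G i j \<noteq> 0}) / card {0..<int (p i)}"
      by (rule measure_pmf_of_set) auto
    also have "\<dots> \<le> real (2 * q i) / p i"
    proof -
      have "{0..<int (p i)} \<inter> {j. G i j \<noteq> 0} \<subseteq> {0..<2 * int (q i)}"
        using G_eq_0[of _ i] by (fastforce simp: not_le[symmetric])
      then have "card ({0..<int (p i)} \<inter> {j. G i j \<noteq> 0}) \<le> card {0..<2 * int (q i)}"
        by (intro card_mono) auto
      also have "\<dots> = 2 * q i" by simp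
      finally show ?thesis by (simp add: divide_right_mono)
    qed
    also have "\<dots> \<le> (1/2) ^ i"
    proof -
      have "2 ^ i * (2 * q i) \<le> p i" using p_large[of i] by linarith
      then have "real (2 ^ i * (2 * q i)) \<le> real (p i)" by (rule of_nat_mono)
      then show ?thesis by (simp add: field_simps)
    qed
    finally show ?thesis .
  qed
  have "AE x in haar. eventually (\<lambda>i. x \<in> space haar - A i) sequentially"
  proof (rule borel_cantelli_AE1)
    show "summable (\<lambda>i. measure haar (A i))"
      by (rule summable_comparison_test'[where g="\<lambda>i. (1/2) ^ i" and N=0]) (auto simp: le)
  qed (auto simp: A H.emeasure_eq_measure)
  then show ?thesis
  proof eventually_elim
    case (elim x)
    then have "eventually (\<lambda>i. G i (x i) = 0) sequentially"
      by eventually_elim (simp add: A_def cyl_def)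
    then have "summable (\<lambda>i. G i (x i)) = summable (\<lambda>i::nat. 0 :: real)"
      by (rule summable_cong)
    then show ?case by simp
  qed
qed

lemma AE_summable_D: "AE x in haar. summable (\<lambda>i. G i (x i + beta i) - G i (x i))"
proof -
  have "AE x in distr haar haar (rot beta). summable (\<lambda>i. G i (x i))"
    unfolding distr_rot by (rule AE_summable_G)
  then have "AE x in haar. summable (\<lambda>i. G i (rot beta x i))"
    by (rule AE_distrD[OF measurable_rot])
  with AE_summable_G show ?thesis
  proof eventually_elim
    case (elim x)
    then show ?case using summable_diff[OF elim(2,1)] by (simp add: rot_def add.commute)
  qed
qed

lemma D_shift:
  assumes "summable (\<lambda>i. G i (x i + beta i) - G i (x i))"
  shows "D (\<lambda>i. x i + 1) = D x + Psi 1 (\<lambda>i. x i + beta i) - Psi 1 x"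
proof -
  have "D x + Psi 1 (\<lambda>i. x i + beta i) - Psi 1 x =
    (\<Sum>i. (G i (x i + beta i) - G i (x i)) + (G i (x i + beta i + 1) - G i (x i + beta i)) - (G i (x i + 1) - G i (x i)))"
    unfolding D_def Psi_def
    by (simp only: suminf_add[OF assms summable_Psi[where x="\<lambda>i. x i + beta i"]]
        suminf_diff[OF summable_add[OF assms summable_Psi[where x="\<lambda>i. x i + beta i"]] summable_Psi])
  also have "\<dots> = D (\<lambda>i. x i + 1)" by (simp add: D_def algebra_simps)
  finally show ?thesis by simp
qed

text \<open>
  The set where the difference of the two fibre coordinates equals \<open>D + c\<close>, parametrised by the base
  point and the first fibre coordinate; it is invariant up to a null set.
\<close>

definition graph :: "real \<Rightarrow> (nat \<Rightarrow> int) \<times> real \<Rightarrow> (nat \<Rightarrow> real) \<times> (nat \<Rightarrow> real)" where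
  "graph c z = (pt (fst z) (snd z), pt (\<lambda>i. fst z i + beta i) (snd z + D (fst z) + c))"

definition graph_measure :: "real \<Rightarrow> ((nat \<Rightarrow> real) \<times> (nat \<Rightarrow> real)) measure" where
  "graph_measure c = distr (haar \<Otimes>\<^sub>M circle_measure) (restrict_space borel J) (graph c)"

lemma graph_in_J [simp]: "graph c z \<in> J"
  by (simp add: graph_def)

lemma measurable_graph: "graph c \<in> measurable (haar \<Otimes>\<^sub>M circle_measure) (restrict_space borel J)"
proof (rule measurable_restrict_space2)
  let ?P = "haar \<Otimes>\<^sub>M circle_measure"
  have snd: "snd \<in> borel_measurable ?P" by measurable
  have D: "(\<lambda>z. D (fst z)) \<in> borel_measurable ?P"
    by (rule measurable_compose[OF measurable_fst measurable_D])
  have "(\<lambda>x. \<lambda>i. x i + beta i) \<in> measurable haar haar"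
    by (rule measurable_into_haar) (rule measurable_haar_fun[where f="\<lambda>j. j + beta i" for i], simp)
  then have "(\<lambda>z. \<lambda>i. fst z i + beta i) \<in> measurable ?P haar"
    by (rule measurable_compose[OF measurable_fst])
  then show "graph c \<in> borel_measurable ?P"
    unfolding graph_def[abs_def]
    by (intro borel_measurable_Pair measurable_pt measurable_fst snd borel_measurable_add D) simp_all
qed simp

lemma prob_space_graph: "prob_space (graph_measure c)"
proof -
  interpret H: prob_space haar by (rule prob_space_haar)
  interpret C: prob_space circle_measure by (rule prob_space_circle_measure)
  interpret pair_prob_space haar circle_measure by unfold_locales
  show ?thesis unfolding graph_measure_def by (rule prob_space_distr[OF measurable_graph])
qed

lemma emeasure_graph:
  assumes A: "A \<in> sets (restrict_space borel J)"
  shows "emeasure (graph_measure c) A =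
    (\<integral>\<^sup>+x. (\<integral>\<^sup>+t. indicator A (graph c (x, t)) \<partial>circle_measure) \<partial>haar)"
    and "(\<lambda>x. \<integral>\<^sup>+t. indicator A (graph c (x, t)) \<partial>circle_measure) \<in> borel_measurable haar"
proof -
  interpret C: prob_space circle_measure by (rule prob_space_circle_measure)
  have m: "(\<lambda>z. indicator A (graph c z) :: ennreal) \<in> borel_measurable (haar \<Otimes>\<^sub>M circle_measure)"
    by (rule measurable_compose[OF measurable_graph borel_measurable_indicator[OF A]])
  have "emeasure (graph_measure c) A = (\<integral>\<^sup>+z. indicator A z \<partial>graph_measure c)"
    using A by (simp add: graph_measure_def)
  also have "\<dots> = (\<integral>\<^sup>+z. indicator A (graph c z) \<partial>(haar \<Otimes>\<^sub>M circle_measure))"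
    unfolding graph_measure_def
    by (rule nn_integral_distr[OF measurable_graph]) (rule borel_measurable_indicator, simp add: A)
  also have "\<dots> = (\<integral>\<^sup>+x. (\<integral>\<^sup>+t. indicator A (graph c (x, t)) \<partial>circle_measure) \<partial>haar)"
    by (rule C.nn_integral_fst[OF m, symmetric])
  finally show "emeasure (graph_measure c) A =
    (\<integral>\<^sup>+x. (\<integral>\<^sup>+t. indicator A (graph c (x, t)) \<partial>circle_measure) \<partial>haar)" .
  show "(\<lambda>x. \<integral>\<^sup>+t. indicator A (graph c (x, t)) \<partial>circle_measure) \<in> borel_measurable haar"
    by (rule C.borel_measurable_nn_integral_fst[OF m])
qed

lemma Phi2_graph:
  assumes "summable (\<lambda>i. G i (x i + beta i) - G i (x i))"
  shows "Phi2 1 (graph c (x, t)) = graph c (rot (\<lambda>_. 1) x, t + (\<alpha> + Psi 1 x))"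
proof -
  have r: "rot (\<lambda>_. 1) x = (\<lambda>i. (x i + 1) mod int (p i))" by (simp add: rot_def fun_eq_iff add.commute)
  have b: "pt (\<lambda>i. (x i + 1) mod int (p i) + beta i) s = pt (\<lambda>i. x i + 1 + beta i) s" for s
    by (rule pt_cong) (simp add: mod_add_left_eq)
  have "Phi2 1 (graph c (x, t)) = (pt (\<lambda>i. x i + 1) (t + (\<alpha> + Psi 1 x)),
      pt (\<lambda>i. x i + 1 + beta i) (t + D x + c + \<alpha> + Psi 1 (\<lambda>i. x i + beta i)))"
    by (simp add: graph_def Phi_pt ac_simps)
  also have "t + D x + c + \<alpha> + Psi 1 (\<lambda>i. x i + beta i) = t + (\<alpha> + Psi 1 x) + D (\<lambda>i. x i + 1) + c"
    unfolding D_shift[OF assms] by simp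
  finally show ?thesis by (simp add: graph_def r b)
qed

lemma graph_measure_invariant: "invariant_borel_prob (top_of_set J) (Phi2 1) (graph_measure c)"
  unfolding invariant_borel_prob_def sets_borel_of_top_of_set
proof (intro conjI ballI)
  interpret prob_space "graph_measure c" by (rule prob_space_graph)
  show space: "space (graph_measure c) = topspace (top_of_set J)"
    and sets: "sets (graph_measure c) = sets (restrict_space borel J)"
    by (simp_all add: graph_measure_def space_restrict_space)
  show "emeasure (graph_measure c) (topspace (top_of_set J)) = 1"
    using emeasure_space_1 space by simp
  fix A assume "A \<in> sets (graph_measure c)"
  then have A: "A \<in> sets (restrict_space borel J)" by (simp add: sets)
  define F where "F x = (\<integral>\<^sup>+t. indicator A (graph c (x, t)) \<partial>circle_measure)" for x
  have A': "Phi2 1 -` A \<inter> J \<in> sets (restrict_space borel J)"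
    using measurable_sets[OF Phi_J.measurable_F A] by (simp add: space_restrict_space)
  have "emeasure (graph_measure c) (Phi2 1 -` A \<inter> topspace (top_of_set J)) =
    (\<integral>\<^sup>+x. (\<integral>\<^sup>+t. indicator (Phi2 1 -` A \<inter> J) (graph c (x, t)) \<partial>circle_measure) \<partial>haar)"
    using emeasure_graph(1)[OF A'] by simp
  also have "\<dots> = (\<integral>\<^sup>+x. F (rot (\<lambda>_. 1) x) \<partial>haar)"
  proof (rule nn_integral_cong_AE)
    show "AE x in haar. (\<integral>\<^sup>+t. indicator (Phi2 1 -` A \<inter> J) (graph c (x, t)) \<partial>circle_measure) = F (rot (\<lambda>_. 1) x)"
      using AE_summable_D
    proof eventually_elim
      case (elim x)
      define y where "y = rot (\<lambda>_. 1) x"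
      have "(\<lambda>t. (y, t)) \<in> measurable borel (haar \<Otimes>\<^sub>M circle_measure)"
        by (rule measurable_Pair) simp_all
      from measurable_compose[OF measurable_compose[OF this measurable_graph] borel_measurable_indicator[OF A]]
      have m: "(\<lambda>t. indicator A (graph c (y, t)) :: ennreal) \<in> borel_measurable borel" .
      have per: "graph c (y, t + of_int h) = graph c (y, t)" for t h
      proof -
        have "t + of_int h + D y + c = (t + D y + c) + of_int h" by simp
        then show ?thesis by (simp only: graph_def fst_conv snd_conv pt_add_int)
      qed
      have "(\<integral>\<^sup>+t. indicator (Phi2 1 -` A \<inter> J) (graph c (x, t)) \<partial>circle_measure)
        = (\<integral>\<^sup>+t. indicator A (graph c (y, t + (\<alpha> + Psi 1 x))) \<partial>circle_measure)"
        by (intro nn_integral_cong) (simp add: indicator_def Phi2_graph[OF elim] y_def del: map_prod_simp)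
      also have "\<dots> = F y"
        unfolding F_def by (rule nn_integral_circle_shift[OF m]) (simp add: per)
      finally show ?case by (simp add: y_def)
    qed
  qed
  also have "\<dots> = (\<integral>\<^sup>+x. F x \<partial>distr haar haar (rot (\<lambda>_. 1)))"
    by (rule nn_integral_distr[symmetric, OF measurable_rot])
      (use emeasure_graph(2)[OF A] in \<open>simp add: F_def[abs_def]\<close>)
  also have "\<dots> = emeasure (graph_measure c) A"
    by (simp add: distr_rot F_def emeasure_graph(1)[OF A])
  finally show "emeasure (graph_measure c) (Phi2 1 -` A \<inter> topspace (top_of_set J)) = emeasure (graph_measure c) A" .
qed

text \<open>
  The two measures live on disjoint sets, as the difference of the fibre coordinates is \<open>D\<close> for one and
  \<open>D + 1/2\<close> for the other.
\<close>

lemma graph_measure_distinct: "graph_measure 0 \<noteq> graph_measure (1/2)"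
proof
  assume eq: "graph_measure 0 = graph_measure (1/2)"
  let ?R = "restrict_space borel J :: ((nat \<Rightarrow> real) \<times> (nat \<Rightarrow> real)) measure"
  define d where "d z = D (base (fst z))" for z :: "(nat \<Rightarrow> real) \<times> (nat \<Rightarrow> real)"
  \<comment> \<open>the pairs whose fibre coordinates differ by \<open>D\<close>\<close>
  define A where "A = {z \<in> space ?R. snd z 0 = fst z 0 * cos (2 * pi * d z) - fst z 1 * sin (2 * pi * d z) \<and>
    snd z 1 = fst z 1 * cos (2 * pi * d z) + fst z 0 * sin (2 * pi * d z)}"
  have fst: "(\<lambda>z. fst z k) \<in> borel_measurable ?R" and snd: "(\<lambda>z. snd z k) \<in> borel_measurable ?R" for k
    by (auto intro!: measurable_restrict_space1 borel_measurable_continuous_onI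
        continuous_on_compose2[OF continuous_on_coord[of UNIV]] continuous_on_fst continuous_on_snd continuous_on_id)
  have "fst \<in> borel_measurable ?R"
    by (intro measurable_restrict_space1 borel_measurable_continuous_onI continuous_on_fst continuous_on_id)
  from measurable_compose[OF measurable_compose[OF this measurable_base] measurable_D]
  have d: "d \<in> borel_measurable ?R" by (simp add: d_def[abs_def])
  note [measurable] = fst snd d
  have A: "A \<in> sets ?R" unfolding A_def by measurable
  have d_graph: "d (graph c (x, t)) = D x" for c x t
    by (simp add: d_def graph_def)
  have in_A: "z \<in> A \<longleftrightarrow> z \<in> J \<and> snd z 0 = act 0 (d z) (fst z) 0 \<and> snd z 1 = act 0 (d z) (fst z) (Suc 0)" for z
    by (auto simp: A_def space_restrict_space act_def)
  have "graph 0 (x, t) \<in> A" for x t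
    unfolding in_A d_graph by (simp add: graph_def act_0_pt)
  moreover have "graph (1/2) (x, t) \<notin> A" for x t
  proof
    assume "graph (1/2) (x, t) \<in> A"
    then have "cos (2 * pi * (t + D x + 1/2)) = cos (2 * pi * (t + D x))"
      "sin (2 * pi * (t + D x + 1/2)) = sin (2 * pi * (t + D x))"
      unfolding in_A d_graph by (simp_all add: graph_def act_0_pt)
    then have "cos (2 * pi * (t + D x)) = 0" "sin (2 * pi * (t + D x)) = 0"
      unfolding distrib_left[of _ _ "1/2"] cos_add sin_add by simp_all
    then show False using sin_cos_squared_add[of "2 * pi * (t + D x)"] by simp
  qed
  ultimately have "emeasure (graph_measure 0) A = (\<integral>\<^sup>+x. (\<integral>\<^sup>+t. 1 \<partial>circle_measure) \<partial>haar)"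
    and "emeasure (graph_measure (1/2)) A = 0"
    by (simp_all add: emeasure_graph(1)[OF A])
  then show False
    using prob_space.emeasure_space_1[OF prob_space_haar] prob_space.emeasure_space_1[OF prob_space_circle_measure]
    by (simp add: eq)
qed

lemma not_strictly_ergodic_J: "\<not> strictly_ergodic_flow (top_of_set J) (Phi2 1)"
  using graph_measure_invariant graph_measure_distinct unfolding strictly_ergodic_flow_def by blast

lemma invariant_exists: "\<exists>\<mu>. invariant_borel_prob (top_of_set W) (Phi 1) \<mu>"
proof -
  let ?M = "graph_measure 0"
  have inv: "invariant_borel_prob (top_of_set J) (Phi2 1) ?M" by (rule graph_measure_invariant)
  then have space: "space ?M = J" and sets: "sets ?M = sets (restrict_space borel J)"
    and inv1: "\<And>A. A \<in> sets ?M \<Longrightarrow> emeasure ?M (Phi2 1 -` A \<inter> J) = emeasure ?M A"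
    by (auto simp: invariant_borel_prob_def sets_borel_of_top_of_set)
  have fst: "fst \<in> measurable ?M (restrict_space borel W)"
  proof -
    have "fst \<in> borel_measurable (restrict_space borel J)"
      by (intro measurable_restrict_space1 borel_measurable_continuous_onI continuous_on_fst continuous_on_id)
    then have "fst \<in> measurable (restrict_space borel J) (restrict_space borel W)"
      using J_subset by (intro measurable_restrict_space2) (auto simp: space_restrict_space)
    then show ?thesis by (simp cong: measurable_cong_sets add: sets)
  qed
  have "invariant_borel_prob (top_of_set W) (Phi 1) (distr ?M (restrict_space borel W) fst)"
    unfolding invariant_borel_prob_def sets_borel_of_top_of_set
  proof (intro conjI ballI)
    let ?\<mu> = "distr ?M (restrict_space borel W) fst"
    show "space ?\<mu> = topspace (top_of_set W)" by (simp add: space_restrict_space)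
    show "sets ?\<mu> = sets (restrict_space borel W)" by simp
    have "prob_space ?\<mu>" by (rule prob_space.prob_space_distr[OF prob_space_graph fst])
    then show "emeasure ?\<mu> (topspace (top_of_set W)) = 1"
      using prob_space.emeasure_space_1 by (fastforce simp: space_restrict_space)
    fix A assume "A \<in> sets ?\<mu>"
    then have A: "A \<in> sets (restrict_space borel W)" by simp
    have A': "Phi 1 -` A \<inter> W \<in> sets (restrict_space borel W)"
      using measurable_sets[OF Phi.measurable_F A] by (simp add: space_restrict_space)
    have "emeasure ?\<mu> (Phi 1 -` A \<inter> topspace (top_of_set W)) = emeasure ?M (fst -` (Phi 1 -` A \<inter> W) \<inter> J)"
      using emeasure_distr[OF fst A'] by (simp add: space)
    also have "fst -` (Phi 1 -` A \<inter> W) \<inter> J = Phi2 1 -` (fst -` A \<inter> J) \<inter> J"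
      using J_subset Phi2_in_J[of _ 1] by auto
    also have "emeasure ?M \<dots> = emeasure ?M (fst -` A \<inter> J)"
      using measurable_sets[OF fst A] by (intro inv1) (simp add: space)
    also have "\<dots> = emeasure ?\<mu> A" using emeasure_distr[OF fst A] by (simp add: space)
    finally show "emeasure ?\<mu> (Phi 1 -` A \<inter> topspace (top_of_set W)) = emeasure ?\<mu> A" .
  qed
  then show ?thesis by blast
qed

lemma strictly_ergodic_W: "strictly_ergodic_flow (top_of_set W) (Phi 1)"
  unfolding strictly_ergodic_flow_def using minimal_W invariant_exists invariant_unique by blast

end

theorem mainTheorem5:
  "\<exists>(W :: (nat \<Rightarrow> real) topology) S.
     metric_flow W S \<and> strictly_ergodic_flow W S \<and> distal_flow W S \<and>
     (\<exists>w \<in> topspace W. \<exists>w' \<in> topspace W.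
        minimal_flow (join_space W w S W w' S) (map_prod S S) \<and>
        \<not> strictly_ergodic_flow (join_space W w S W w' S) (map_prod S S))"
proof -
  obtain \<alpha> p q N where "tower \<alpha> p q N" using tower_exists by blast
  then interpret tower \<alpha> p q N .
  have join: "minimal_flow (join_space (top_of_set W) (pt (\<lambda>_. 0) 0) (Phi 1) (top_of_set W) (pt beta 0) (Phi 1)) (Phi2 1)"
    "\<not> strictly_ergodic_flow (join_space (top_of_set W) (pt (\<lambda>_. 0) 0) (Phi 1) (top_of_set W) (pt beta 0) (Phi 1)) (Phi2 1)"
    unfolding join_space_eq by (rule minimal_J, rule not_strictly_ergodic_J)
  have "\<exists>w \<in> topspace (top_of_set W). \<exists>w' \<in> topspace (top_of_set W).
      minimal_flow (join_space (top_of_set W) w (Phi 1) (top_of_set W) w' (Phi 1)) (Phi2 1) \<and>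
      \<not> strictly_ergodic_flow (join_space (top_of_set W) w (Phi 1) (top_of_set W) w' (Phi 1)) (Phi2 1)"
    by (rule bexI[of _ "pt (\<lambda>_. 0) 0"], rule bexI[of _ "pt beta 0"]) (simp_all add: join)
  then show ?thesis using Phi.metric_flow strictly_ergodic_W distal_W by blast
qed

end
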